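(* Let $\theta\in\mathbb{R}\setminus\{0\}$ satisfy $2(9+\sqrt{17})\,\tilde\gamma\,|\theta|<1$, and let $f:\mathbb{R}\to\mathbb{R}$ be a $\mathcal{C}^1$ function with $|f'|\le1$. For $g\in\mathbb{R}^N$ put $F(g):=N^{-1}\sum_{i\le N}f(g_i)$. Then $$\Big\langle\Big(F(g)-\int_{[0,\tilde\gamma]}\int_{\mathbb{R}}f(x)\,d\mu_\gamma(x)\,d\rho(\gamma)\Big)^2\Big\rangle\xrightarrow[N\to\infty]{}0.$$
   Context: Eigenvalues. Fix $\tilde\gamma>0$. For each $N\ge1$ let $\gamma_1=\gamma^{(N)}_1,\dots,\gamma_N=\gamma_N^{(N)}$ be deterministic real numbers in $[0,\tilde\gamma]$ such that the empirical measures $N^{-1}\sum_{i\le N}\delta_{\gamma_i^{(N)}}$ converge, as $N\to\infty$, in the 1-Wasserstein metric to a probability measure $\rho$ on $[0,\tilde\gamma]$. Model. For $g\in\mathbb{R}^N\setminus\{0\}$ let $H_N(g):=N\sum_{i\le N}\gamma_i\, g_i^2/\|g\|^2$. Let $G$ be the standard normal measure on $\mathbb{R}^N$. For $\theta\in\mathbb{R}$ the Gibbs mean is $\langle f(g)\rangle:=\frac{1}{Z_N}\int_{\mathbb{R}^N}f(g)\,e^{\theta H_N(g)}\,dG(g)$ with $Z_N:=\int e^{\theta H_N}dG$. Transforms. For $z\in\mathbb{R}\setminus[0,\tilde\gamma]$ let $S_\rho(z):=\int\frac{\rho(d\gamma)}{z-\gamma}$, $S_{\max}:=\lim_{z\downarrow\tilde\gamma}S_\rho(z)\in(0,+\infty]$,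 $S_{\min}:=\lim_{z\uparrow0}S_\rho(z)\in[-\infty,0)$. $S_\rho$ is a bijection from $\mathbb{R}\setminus[0,\tilde\gamma]$ onto $(S_{\min},S_{\max})\setminus\{0\}$ with inverse $K_\rho$; the R-transform is $R_\rho(x):=K_\rho(x)-1/x$ on $(S_{\min},S_{\max})\setminus\{0\}$. Put $T_\rho:=(S_{\min}/2,S_{\max}/2)\setminus\{0\}$ and, for $\theta\in T_\rho$, $v(\theta):=R_\rho(2\theta)$. (Since $|S_{\min}|,S_{\max}\ge1/\tilde\gamma$, every $\theta$ in the claim belongs to $T_\rho$.) Limiting marginals. For $\gamma\in[0,\tilde\gamma]$, $\mu_\gamma$ is the law of a centred normal random variable with variance $\sigma_\gamma^2:=1/(1+2\theta(v(\theta)-\gamma))$ (which is positive for $\theta\in T_\rho$). *)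

theory Defs
  imports "HOL-Probability.Probability"
begin

definition couplings :: "real measure \<Rightarrow> real measure \<Rightarrow> (real \<times> real) measure set" where
  "couplings \<mu> \<nu> = {\<pi>. sets \<pi> = sets (borel \<Otimes>\<^sub>M borel) \<and>
     distr \<pi> borel fst = \<mu> \<and> distr \<pi> borel snd = \<nu>}"

definition wasserstein1 :: "real measure \<Rightarrow> real measure \<Rightarrow> ennreal" where
  "wasserstein1 \<mu> \<nu> = (INF \<pi>\<in>couplings \<mu> \<nu>. \<integral>\<^sup>+ p. ennreal \<bar>fst p - snd p\<bar> \<partial>\<pi>)"

text \<open>The empirical measure is the law of \<open>a i\<close> for a uniformly distributed index \<open>i\<close>.\<close>

definition empirical_measure :: "nat \<Rightarrow> (nat \<Rightarrow> real) \<Rightarrow> real measure" where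
  "empirical_measure N a = distr (uniform_count_measure {1..N}) borel a"

text \<open>Vectors of dimension \<open>N\<close> are functions on the index set \<open>{1..N}\<close>. At the zero
  vector the division below yields the value 0; that point is a null set of
  \<open>std_gaussian N\<close> for \<open>N \<ge> 1\<close>.\<close>

definition std_gaussian :: "nat \<Rightarrow> (nat \<Rightarrow> real) measure" where
  "std_gaussian N = Pi\<^sub>M {1..N} (\<lambda>_. density lborel (\<lambda>x. ennreal (std_normal_density x)))"

definition hamiltonian :: "nat \<Rightarrow> (nat \<Rightarrow> real) \<Rightarrow> (nat \<Rightarrow> real) \<Rightarrow> real" where
  "hamiltonian N a g = real N * (\<Sum>i\<in>{1..N}. a i * (g i)\<^sup>2 / (L2_set g {1..N})\<^sup>2)"

definition partition_function :: "nat \<Rightarrow> (nat \<Rightarrow> real) \<Rightarrow> real \<Rightarrow> real" where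
  "partition_function N a \<theta> = (\<integral>g. exp (\<theta> * hamiltonian N a g) \<partial>std_gaussian N)"

definition gibbs_mean ::
    "nat \<Rightarrow> (nat \<Rightarrow> real) \<Rightarrow> real \<Rightarrow> ((nat \<Rightarrow> real) \<Rightarrow> real) \<Rightarrow> real" where
  "gibbs_mean N a \<theta> \<phi> = 1 / partition_function N a \<theta> *
     (\<integral>g. \<phi> g * exp (\<theta> * hamiltonian N a g) \<partial>std_gaussian N)"

definition stieltjes :: "real measure \<Rightarrow> real \<Rightarrow> real" where
  "stieltjes \<rho> z = (\<integral>y. 1 / (z - y) \<partial>\<rho>)"

text \<open>In the next three definitions \<open>c\<close> is the right end point of the interval \<open>{0..c}\<close>
  that carries \<open>\<rho>\<close>. Off this interval the transform \<open>stieltjes \<rho>\<close> is injective, with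
  image the open interval between its one-sided limits at 0 and at \<open>c\<close>, minus the point 0;
  \<open>stieltjes_inv\<close> is meaningful on that image, \<open>R_transform\<close> likewise, and \<open>v_fun\<close> for
  arguments \<open>\<theta>\<close> with \<open>2 * \<theta>\<close> in it.\<close>

definition stieltjes_inv :: "real \<Rightarrow> real measure \<Rightarrow> real \<Rightarrow> real" where
  "stieltjes_inv c \<rho> = inv_into (UNIV - {0..c}) (stieltjes \<rho>)"

definition R_transform :: "real \<Rightarrow> real measure \<Rightarrow> real \<Rightarrow> real" where
  "R_transform c \<rho> x = stieltjes_inv c \<rho> x - 1 / x"

definition v_fun :: "real \<Rightarrow> real measure \<Rightarrow> real \<Rightarrow> real" where
  "v_fun c \<rho> \<theta> = R_transform c \<rho> (2 * \<theta>)"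

definition limit_variance :: "real \<Rightarrow> real measure \<Rightarrow> real \<Rightarrow> real \<Rightarrow> real" where
  "limit_variance c \<rho> \<theta> y = 1 / (1 + 2 * \<theta> * (v_fun c \<rho> \<theta> - y))"

text \<open>The second argument of \<open>normal_density\<close> is the standard deviation, not the variance.\<close>

definition limit_marginal :: "real \<Rightarrow> real measure \<Rightarrow> real \<Rightarrow> real \<Rightarrow> real measure" where
  "limit_marginal c \<rho> \<theta> y =
     density lborel (\<lambda>x. ennreal (normal_density 0 (sqrt (limit_variance c \<rho> \<theta> y)) x))"

end

theory Submission
  imports Defs
begin

text \<open>
  Let \<open>w\<close> solve \<open>\<Sum>i. s i = N\<close> with \<open>s i = 1 / (1 + 2 * \<theta> * (w - \<gamma> N i))\<close>, and let \<open>y i = sqrt (s i) * z i\<close>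
  with \<open>z\<close> standard normal. Under the Gibbs measure the direction \<open>g / |g|\<close> is independent of the
  radius \<open>|g|\<close>. Its density with respect to the direction of \<open>y\<close> is proportional to
  \<open>exp (- N / 2 * (t - ln (1 + t)))\<close> with \<open>1 + t = |z|\<^sup>2 / |y|\<^sup>2\<close>. The exponent is nonpositive, and
  because \<open>t\<close> has order \<open>1 / sqrt N\<close> under the law of \<open>y\<close> (this is what the choice of \<open>w\<close> achieves) the
  normalising constant is bounded. So Gibbs means of nonnegative functions are dominated,
  uniformly in \<open>N\<close>, by means under the product measure with a resampled radius, where the claim is
  a variance computation. The bias tends to zero since \<open>w\<close> and the Gaussian means are Lipschitz
  functions with respect to the Wasserstein distance.
\<close>

section \<open>Scaling in product spaces\<close>

text \<open>The energy is a quotient of quadratic forms, so the Gibbs measure is neither Gaussian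
  nor a product. It is invariant under scaling, however, so that the tilt acts on the direction
  alone. Every shift \<open>w\<close> with positive variances gives an exact formula for the law of
  the direction. If the mean of the \<open>s i\<close> stays away from 1, then \<open>t\<close>
  concentrates at a nonzero value and the mass of the unnormalised density decays exponentially in
  \<open>N\<close>. The equation for \<open>w\<close> gives |y|^2 and |z|^2 the same mean
  \<open>N\<close>, which removes this effect. Multiplied by \<open>2 * \<theta> / N\<close> it says
  that the Stieltjes transform of the empirical measure takes the value \<open>2 * \<theta>\<close>
  at \<open>w + 1 / (2 * \<theta>)\<close>; so \<open>w\<close> is the R-transform of the empirical
  measure at \<open>2 * \<theta>\<close>, the finite-dimensional counterpart of v(\<theta>). Since
  the comparison costs a constant factor, second moments suffice and no tail estimate is
  made.\<close>

definition dilate :: "'i set \<Rightarrow> ('i \<Rightarrow> real) \<Rightarrow> ('i \<Rightarrow> real) \<Rightarrow> 'i \<Rightarrow> real" where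
  "dilate I d x = (\<lambda>i\<in>I. d i * x i)"

lemma measurable_dilate [measurable]:
  assumes [measurable]: "\<And>i. i \<in> I \<Longrightarrow> (\<lambda>w. d w i) \<in> borel_measurable M"
    "g \<in> measurable M (PiM I (\<lambda>_. borel))"
  shows "(\<lambda>w. dilate I (d w) (g w)) \<in> measurable M (PiM I (\<lambda>_. borel))"
  unfolding dilate_def by (rule measurable_restrict) measurable

lemma measurable_L2_set_PiM [measurable]:
  assumes [measurable]: "g \<in> measurable M (PiM I (\<lambda>_. borel))"
  shows "(\<lambda>w. L2_set (g w) I) \<in> borel_measurable M"
  unfolding L2_set_def by measurable

lemma dilate_dilate: "dilate I a (dilate I b x) = dilate I (\<lambda>i. a i * b i) x"
  by (auto simp: dilate_def fun_eq_iff)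

lemma L2_set_dilate_const: "c \<ge> 0 \<Longrightarrow> L2_set (dilate I (\<lambda>_. c) x) I = c * L2_set x I"
proof -
  assume c: "c \<ge> 0"
  have "L2_set (dilate I (\<lambda>_. c) x) I = L2_set (\<lambda>i. c * x i) I"
    by (rule L2_set_cong) (auto simp: dilate_def)
  then show ?thesis using c by (simp add: L2_set_right_distrib)
qed

text \<open>Change of variables for a diagonal map. Product measures are determined by boxes, and on
  a box each side factors into the one-dimensional affine rule.\<close>

lemma PiM_lborel_dilate:
  fixes d :: "'i \<Rightarrow> real"
  assumes "finite I" and d: "\<And>i. i \<in> I \<Longrightarrow> d i > 0"
    and \<phi>[measurable]: "\<phi> \<in> borel_measurable (PiM I (\<lambda>_. borel))"
  shows "(\<integral>\<^sup>+x. \<phi> x \<partial>PiM I (\<lambda>_. lborel))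
    = ennreal (\<Prod>i\<in>I. d i) * (\<integral>\<^sup>+x. \<phi> (dilate I d x) \<partial>PiM I (\<lambda>_. lborel))"
proof -
  let ?L = "PiM I (\<lambda>_. lborel :: real measure)"
  interpret product_sigma_finite "\<lambda>_::'i. lborel :: real measure"
    by standard
  have sets_L: "sets ?L = sets (PiM I (\<lambda>_. borel))"
    by (rule sets_PiM_cong) auto
  have meas: "dilate I d \<in> measurable ?L ?L"
    by (subst measurable_cong_sets[OF sets_L sets_L]) measurable
  have one: "emeasure lborel A = ennreal (d i) * emeasure lborel ((\<lambda>x. d i * x) -` A)"
    if "i \<in> I" "A \<in> sets borel" for A i
  proof -
    have "emeasure lborel A = emeasure (density (distr lborel borel (\<lambda>x. 0 + d i * x)) (\<lambda>_. ennreal (abs (d i)))) A"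
      using lborel_real_affine[of "d i" 0] d[OF that(1)] by auto
    also have "\<dots> = ennreal (d i) * emeasure lborel ((\<lambda>x. d i * x) -` A)"
      using that d[OF that(1)] by (simp add: emeasure_density_const emeasure_distr)
    finally show ?thesis .
  qed
  have "density (distr ?L ?L (dilate I d)) (\<lambda>_. ennreal (\<Prod>i\<in>I. d i)) = ?L"
  proof (rule PiM_eqI)
    fix A :: "'i \<Rightarrow> real set" assume A: "\<And>i. i \<in> I \<Longrightarrow> A i \<in> sets lborel"
    have PA: "Pi\<^sub>E I A \<in> sets ?L" using A assms(1) by (intro sets_PiM_I_finite) auto
    have v: "dilate I d -` Pi\<^sub>E I A \<inter> space ?L = Pi\<^sub>E I (\<lambda>i. (\<lambda>x. d i * x) -` A i)"
      by (auto simp: dilate_def space_PiM PiE_iff)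
    have "emeasure (density (distr ?L ?L (dilate I d)) (\<lambda>_. ennreal (\<Prod>i\<in>I. d i))) (Pi\<^sub>E I A)
      = ennreal (\<Prod>i\<in>I. d i) * emeasure ?L (Pi\<^sub>E I (\<lambda>i. (\<lambda>x. d i * x) -` A i))"
      using PA meas by (simp add: emeasure_density_const emeasure_distr v)
    also have "emeasure ?L (Pi\<^sub>E I (\<lambda>i. (\<lambda>x. d i * x) -` A i))
       = (\<Prod>i\<in>I. emeasure lborel ((\<lambda>x. d i * x) -` A i))"
    proof (rule emeasure_PiM[OF assms(1)])
      fix i assume "i \<in> I"
      then have [measurable]: "A i \<in> sets borel" using A by auto
      have "(\<lambda>x. d i * x) -` A i \<inter> space borel \<in> sets borel" by measurable
      then show "(\<lambda>x. d i * x) -` A i \<in> sets lborel" by simp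
    qed
    also have "ennreal (\<Prod>i\<in>I. d i) * (\<Prod>i\<in>I. emeasure lborel ((\<lambda>x. d i * x) -` A i))
      = (\<Prod>i\<in>I. ennreal (d i) * emeasure lborel ((\<lambda>x. d i * x) -` A i))"
      using d by (simp add: prod_ennreal[symmetric] less_imp_le prod.distrib)
    also have "\<dots> = (\<Prod>i\<in>I. emeasure lborel (A i))"
      using A by (intro prod.cong refl one[symmetric]) auto
    finally show "emeasure (density (distr ?L ?L (dilate I d)) (\<lambda>_. ennreal (\<Prod>i\<in>I. d i))) (Pi\<^sub>E I A)
      = (\<Prod>i\<in>I. emeasure lborel (A i))" .
  qed (use assms in auto)
  then have "(\<integral>\<^sup>+x. \<phi> x \<partial>?L) = (\<integral>\<^sup>+x. \<phi> x \<partial>density (distr ?L ?L (dilate I d)) (\<lambda>_. ennreal (\<Prod>i\<in>I. d i)))"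
    by simp
  also have "\<dots> = ennreal (\<Prod>i\<in>I. d i) * (\<integral>\<^sup>+x. \<phi> x \<partial>distr ?L ?L (dilate I d))"
    using \<phi> by (subst nn_integral_density) (auto intro!: nn_integral_cmult simp: measurable_cong_sets[OF sets_L refl])
  also have "(\<integral>\<^sup>+x. \<phi> x \<partial>distr ?L ?L (dilate I d)) = (\<integral>\<^sup>+x. \<phi> (dilate I d x) \<partial>?L)"
    using \<phi> by (intro nn_integral_distr meas) (auto simp: measurable_cong_sets[OF sets_L refl])
  finally show ?thesis .
qed

lemma PiM_density_lborel:
  fixes p :: "real \<Rightarrow> ennreal"
  assumes "finite I" and [measurable]: "p \<in> borel_measurable borel"
    and "sigma_finite_measure (density lborel p)"
  shows "PiM I (\<lambda>_. density lborel p) = density (PiM I (\<lambda>_. lborel)) (\<lambda>x. \<Prod>i\<in>I. p (x i))"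
proof -
  interpret L: product_sigma_finite "\<lambda>_::'a. lborel :: real measure"
    by standard
  interpret product_sigma_finite "\<lambda>_::'a. density lborel p"
    using assms(3) by (simp add: product_sigma_finite_def)
  show ?thesis
  proof (rule PiM_eqI[symmetric])
    show "sets (density (PiM I (\<lambda>_. lborel)) (\<lambda>x. \<Prod>i\<in>I. p (x i))) = sets (PiM I (\<lambda>_. density lborel p))"
      by (auto intro!: sets_PiM_cong)
    fix A assume A: "\<And>i. i \<in> I \<Longrightarrow> A i \<in> sets (density lborel p)"
    have PA: "Pi\<^sub>E I A \<in> sets (PiM I (\<lambda>_. lborel))" using A assms(1) by (intro sets_PiM_I_finite) auto
    have "emeasure (density (PiM I (\<lambda>_. lborel)) (\<lambda>x. \<Prod>i\<in>I. p (x i))) (Pi\<^sub>E I A)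
      = (\<integral>\<^sup>+x. (\<Prod>i\<in>I. p (x i)) * indicator (Pi\<^sub>E I A) x \<partial>PiM I (\<lambda>_. lborel))"
      using PA by (intro emeasure_density) auto
    also have "\<dots> = (\<integral>\<^sup>+x. (\<Prod>i\<in>I. p (x i) * indicator (A i) (x i)) \<partial>PiM I (\<lambda>_. lborel))"
    proof (rule nn_integral_cong)
      fix x assume "x \<in> space (PiM I (\<lambda>_. lborel :: real measure))"
      then have "indicator (Pi\<^sub>E I A) x = (\<Prod>i\<in>I. indicator (A i) (x i) :: ennreal)"
        using assms(1) by (auto simp: indicator_def space_PiM PiE_iff prod_zero_iff split: if_splits)
      then show "(\<Prod>i\<in>I. p (x i)) * indicator (Pi\<^sub>E I A) x = (\<Prod>i\<in>I. p (x i) * indicator (A i) (x i))"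
        by (simp add: prod.distrib)
    qed
    also have "\<dots> = (\<Prod>i\<in>I. \<integral>\<^sup>+x. p x * indicator (A i) x \<partial>lborel)"
      using A assms(1) by (intro L.product_nn_integral_prod) auto
    also have "\<dots> = (\<Prod>i\<in>I. emeasure (density lborel p) (A i))"
      using A by (intro prod.cong refl) (simp add: emeasure_density)
    finally show "emeasure (density (PiM I (\<lambda>_. lborel)) (\<lambda>x. \<Prod>i\<in>I. p (x i))) (Pi\<^sub>E I A)
      = (\<Prod>i\<in>I. emeasure (density lborel p) (A i))" .
  qed fact
qed

text \<open>Integrating against the Haar measure of the multiplicative group, with \<open>s = exp u\<close>, makes
  the inversion of the scale a reflection.\<close>

lemma scale_exchange:
  fixes \<psi> \<eta> :: "('i \<Rightarrow> real) \<Rightarrow> ennreal"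
  assumes "finite I" and [measurable]: "\<psi> \<in> borel_measurable (PiM I (\<lambda>_. borel))"
    "\<eta> \<in> borel_measurable (PiM I (\<lambda>_. borel))"
  defines "n \<equiv> card I" and "L \<equiv> PiM I (\<lambda>_. lborel :: real measure)"
  shows "(\<integral>\<^sup>+y. \<eta> y * ennreal (L2_set y I ^ n) *
             (\<integral>\<^sup>+u. \<psi> (dilate I (\<lambda>_. exp u) y) * ennreal (exp (n * u)) \<partial>lborel) \<partial>L)
    = (\<integral>\<^sup>+y. \<psi> y * ennreal (L2_set y I ^ n) *
             (\<integral>\<^sup>+u. \<eta> (dilate I (\<lambda>_. exp u) y) * ennreal (exp (n * u)) \<partial>lborel) \<partial>L)"
proof -
  have sets_L[measurable_cong]: "sets L = sets (PiM I (\<lambda>_. borel))"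
    unfolding L_def by (rule sets_PiM_cong) auto
  have "sigma_finite_measure L"
    unfolding L_def using assms(1)
    by (intro product_sigma_finite.sigma_finite) (auto simp: product_sigma_finite_def sigma_finite_lborel)
  then interpret pair_sigma_finite L lborel
    by (simp add: pair_sigma_finite_def sigma_finite_lborel)
  have cmult: "(\<integral>\<^sup>+y. \<eta> y * ennreal (L2_set y I ^ n) *
             (\<integral>\<^sup>+u. \<psi> (dilate I (\<lambda>_. exp u) y) * ennreal (exp (n * u)) \<partial>lborel) \<partial>L)
    = (\<integral>\<^sup>+y. (\<integral>\<^sup>+u. \<eta> y * ennreal (L2_set y I ^ n) * (\<psi> (dilate I (\<lambda>_. exp u) y) * ennreal (exp (n * u))) \<partial>lborel) \<partial>L)"
    if [measurable]: "\<psi> \<in> borel_measurable (PiM I (\<lambda>_. borel))" for \<psi> \<eta> :: "('i \<Rightarrow> real) \<Rightarrow> ennreal"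
  proof (intro nn_integral_cong nn_integral_cmult[symmetric])
    fix y assume "y \<in> space L"
    then have [measurable]: "y \<in> space (PiM I (\<lambda>_. borel))" by (simp add: L_def space_PiM)
    show "(\<lambda>u. \<psi> (dilate I (\<lambda>_. exp u) y) * ennreal (exp (n * u))) \<in> borel_measurable lborel"
      by measurable
  qed
  have "(\<integral>\<^sup>+y. \<eta> y * ennreal (L2_set y I ^ n) *
             (\<integral>\<^sup>+u. \<psi> (dilate I (\<lambda>_. exp u) y) * ennreal (exp (n * u)) \<partial>lborel) \<partial>L)
    = (\<integral>\<^sup>+y. (\<integral>\<^sup>+u. \<eta> y * ennreal (L2_set y I ^ n) * (\<psi> (dilate I (\<lambda>_. exp u) y) * ennreal (exp (n * u))) \<partial>lborel) \<partial>L)"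
    by (rule cmult) fact
  also have "\<dots> = (\<integral>\<^sup>+u. (\<integral>\<^sup>+y. \<eta> y * ennreal (L2_set y I ^ n) * (\<psi> (dilate I (\<lambda>_. exp u) y) * ennreal (exp (n * u))) \<partial>L) \<partial>lborel)"
    by (rule Fubini'[symmetric]) measurable
  also have "\<dots> = (\<integral>\<^sup>+u. (\<integral>\<^sup>+y. \<psi> y * ennreal (L2_set y I ^ n) * (\<eta> (dilate I (\<lambda>_. exp (-u)) y) * ennreal (exp (n * (-u)))) \<partial>L) \<partial>lborel)"
  proof (rule nn_integral_cong)
    fix u :: real
    have pr: "(\<Prod>i\<in>I. exp u) = exp (n * u)"
      by (simp add: n_def exp_of_nat_mult)
    \<comment> \<open>The substitution of \<open>exp u * y\<close> for \<open>y\<close> produces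
      \<open>exp (n * u)\<close> twice, as the Jacobian and from the weight
      \<open>L2_set y I ^ n\<close>, which is homogeneous of degree \<open>n\<close>. The factor
      \<open>exp (n * (-u))\<close> takes one of them back.\<close>
    have "(\<integral>\<^sup>+y. \<psi> y * ennreal (L2_set y I ^ n) * (\<eta> (dilate I (\<lambda>_. exp (-u)) y) * ennreal (exp (n * (-u)))) \<partial>L)
      = ennreal (exp (n * u)) * (\<integral>\<^sup>+y. \<psi> (dilate I (\<lambda>_. exp u) y) * ennreal (L2_set (dilate I (\<lambda>_. exp u) y) I ^ n)
           * (\<eta> (dilate I (\<lambda>_. exp (-u)) (dilate I (\<lambda>_. exp u) y)) * ennreal (exp (n * (-u)))) \<partial>L)"
      unfolding L_def pr[symmetric] using assms(1) by (intro PiM_lborel_dilate) auto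
    also have "\<dots> = ennreal (exp (n * u)) * (\<integral>\<^sup>+y. \<psi> (dilate I (\<lambda>_. exp u) y) * ennreal (L2_set y I ^ n) * \<eta> y \<partial>L)"
    proof (rule arg_cong2[where f="(*)", OF refl], rule nn_integral_cong)
      fix y assume "y \<in> space L"
      then have y: "dilate I (\<lambda>_. exp (-u)) (dilate I (\<lambda>_. exp u) y) = y"
        by (simp add: dilate_dilate flip: exp_add) (auto simp: dilate_def L_def space_PiM)
      have e: "ennreal ((exp u * L2_set y I) ^ n) * ennreal (exp (n * (-u))) = ennreal (L2_set y I ^ n)"
        by (subst ennreal_mult[symmetric])
           (auto simp: power_mult_distrib L2_set_nonneg exp_of_nat_mult[symmetric] exp_minus field_simps)
      have "\<psi> (dilate I (\<lambda>_. exp u) y) * ennreal (L2_set (dilate I (\<lambda>_. exp u) y) I ^ n)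
           * (\<eta> (dilate I (\<lambda>_. exp (-u)) (dilate I (\<lambda>_. exp u) y)) * ennreal (exp (n * (-u))))
        = \<psi> (dilate I (\<lambda>_. exp u) y) * (ennreal ((exp u * L2_set y I) ^ n) * ennreal (exp (n * (-u)))) * \<eta> y"
        by (subst y, subst L2_set_dilate_const) (auto simp: mult_ac)
      then show "\<psi> (dilate I (\<lambda>_. exp u) y) * ennreal (L2_set (dilate I (\<lambda>_. exp u) y) I ^ n)
           * (\<eta> (dilate I (\<lambda>_. exp (-u)) (dilate I (\<lambda>_. exp u) y)) * ennreal (exp (n * (-u))))
        = \<psi> (dilate I (\<lambda>_. exp u) y) * ennreal (L2_set y I ^ n) * \<eta> y"
        by (simp only: e)
    qed
    also have "\<dots> = (\<integral>\<^sup>+y. \<eta> y * ennreal (L2_set y I ^ n) * (\<psi> (dilate I (\<lambda>_. exp u) y) * ennreal (exp (n * u))) \<partial>L)"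
      by (subst nn_integral_cmult[symmetric]) (auto intro!: nn_integral_cong simp: mult_ac)
    finally show "(\<integral>\<^sup>+y. \<eta> y * ennreal (L2_set y I ^ n) * (\<psi> (dilate I (\<lambda>_. exp u) y) * ennreal (exp (n * u))) \<partial>L)
      = (\<integral>\<^sup>+y. \<psi> y * ennreal (L2_set y I ^ n) * (\<eta> (dilate I (\<lambda>_. exp (-u)) y) * ennreal (exp (n * (-u)))) \<partial>L)" ..
  qed
  also have "\<dots> = (\<integral>\<^sup>+u. (\<integral>\<^sup>+y. \<psi> y * ennreal (L2_set y I ^ n) * (\<eta> (dilate I (\<lambda>_. exp u) y) * ennreal (exp (n * u))) \<partial>L) \<partial>lborel)"
    by (subst nn_integral_real_affine[where c="-1" and t=0]) auto
  also have "\<dots> = (\<integral>\<^sup>+y. (\<integral>\<^sup>+u. \<psi> y * ennreal (L2_set y I ^ n) * (\<eta> (dilate I (\<lambda>_. exp u) y) * ennreal (exp (n * u))) \<partial>lborel) \<partial>L)"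
    by (rule Fubini') measurable
  finally show ?thesis
    by (simp only: cmult[OF assms(3)])
qed

section \<open>Polar decomposition of the standard Gaussian\<close>

abbreviation std_normal :: "real measure" where
  "std_normal \<equiv> density lborel (\<lambda>x. ennreal (std_normal_density x))"

lemma prob_space_std_normal: "prob_space std_normal"
  by (rule prob_space_normal_density) simp

lemma sets_std_gaussian [measurable_cong]:
  "sets (std_gaussian N) = sets (PiM {1..N} (\<lambda>_. borel))"
  unfolding std_gaussian_def by (rule sets_PiM_cong) auto

lemma space_std_gaussian: "space (std_gaussian N) = PiE {1..N} (\<lambda>_. UNIV)"
  by (simp add: std_gaussian_def space_PiM)

lemma prob_space_std_gaussian: "prob_space (std_gaussian N)"
  unfolding std_gaussian_def by (intro prob_space_PiM prob_space_std_normal)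

text \<open>The N-dimensional standard Gaussian density as a function of the norm of its
  argument.\<close>

definition gauss_radial :: "nat \<Rightarrow> real \<Rightarrow> real" where
  "gauss_radial N r = (1 / sqrt (2 * pi)) ^ N * exp (- r\<^sup>2 / 2)"

lemma gauss_radial_pos: "gauss_radial N r > 0"
  by (simp add: gauss_radial_def)

lemma measurable_gauss_radial [measurable]: "gauss_radial N \<in> borel_measurable borel"
  unfolding gauss_radial_def by measurable

lemma std_gaussian_density:
  "std_gaussian N = density (PiM {1..N} (\<lambda>_. lborel)) (\<lambda>x. ennreal (gauss_radial N (L2_set x {1..N})))"
proof -
  have "(\<Prod>i\<in>{1..N}. ennreal (std_normal_density (x i))) = ennreal (gauss_radial N (L2_set x {1..N}))" for x
  proof -
    have "(\<Prod>i\<in>{1..N}. std_normal_density (x i)) = (1 / sqrt (2 * pi)) ^ N * exp (\<Sum>i\<in>{1..N}. - (x i)\<^sup>2 / 2)"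
      by (simp add: normal_density_def prod.distrib prod_constant exp_sum prod_dividef power_one_over)
    also have "(\<Sum>i\<in>{1..N}. - (x i)\<^sup>2 / 2) = - (L2_set x {1..N})\<^sup>2 / 2"
      by (simp add: L2_set_def sum_nonneg sum_negf flip: sum_divide_distrib)
    finally show ?thesis by (simp add: prod_ennreal gauss_radial_def)
  qed
  then show ?thesis
    unfolding std_gaussian_def
    by (subst PiM_density_lborel) (auto intro: prob_space_imp_sigma_finite prob_space_std_normal)
qed

lemma AE_std_gaussian_L2_set_pos:
  assumes "N \<ge> 1"
  shows "AE x in std_gaussian N. L2_set x {1..N} > 0"
proof -
  have "AE x in std_normal. x \<noteq> 0"
    by (subst AE_density) (auto simp: AE_lborel_singleton intro: AE_mp[OF AE_lborel_singleton[of 0]])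
  then have "AE x in std_gaussian N. x 1 \<noteq> 0"
    unfolding std_gaussian_def using assms by (intro AE_PiM_component prob_space_std_normal) auto
  then show ?thesis
  proof (rule AE_mp, intro AE_I2 impI)
    fix x :: "nat \<Rightarrow> real" assume "x 1 \<noteq> 0"
    then have "L2_set x {1..N} \<noteq> 0" using assms by (auto simp: L2_set_eq_0_iff)
    then show "L2_set x {1..N} > 0" using L2_set_nonneg[of x "{1..N}"] by linarith
  qed
qed

text \<open>Translation of \<open>u\<close> by \<open>ln r\<close>, that is, invariance of the
  multiplicative Haar measure. It makes integrals along a ray independent of the vector chosen to
  represent the ray.\<close>

lemma nn_integral_exp_scale:
  fixes h :: "real \<Rightarrow> ennreal"
  assumes [measurable]: "h \<in> borel_measurable borel" and "r > 0"
  shows "ennreal (r ^ n) * (\<integral>\<^sup>+u. h (exp u * r) * ennreal (exp (n * u)) \<partial>lborel)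
    = (\<integral>\<^sup>+u. h (exp u) * ennreal (exp (n * u)) \<partial>lborel)"
proof -
  have "(\<integral>\<^sup>+u. h (exp u) * ennreal (exp (n * u)) \<partial>lborel)
      = (\<integral>\<^sup>+u. h (exp (ln r + 1 * u)) * ennreal (exp (n * (ln r + 1 * u))) \<partial>lborel)"
    by (subst nn_integral_real_affine[where c=1 and t="ln r"]) auto
  also have "\<dots> = (\<integral>\<^sup>+u. ennreal (r ^ n) * (h (exp u * r) * ennreal (exp (n * u))) \<partial>lborel)"
  proof (rule nn_integral_cong)
    fix u :: real
    have "exp (n * (ln r + 1 * u)) = r ^ n * exp (n * u)"
      using assms(2) by (simp add: distrib_left exp_add exp_of_nat_mult)
    then show "h (exp (ln r + 1 * u)) * ennreal (exp (n * (ln r + 1 * u)))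
       = ennreal (r ^ n) * (h (exp u * r) * ennreal (exp (n * u)))"
      using assms(2) by (simp add: exp_add ennreal_mult mult_ac)
  qed
  finally show ?thesis by (simp add: nn_integral_cmult)
qed

text \<open>With \<open>r = exp u\<close> this is the integral of
  \<open>gauss_radial N r * r ^ (N - 1)\<close> over positive \<open>r\<close>: for
  \<open>N \<ge> 1\<close>, the reciprocal of the area of the unit sphere.\<close>

definition chi_norm :: "nat \<Rightarrow> ennreal" where
  "chi_norm N = (\<integral>\<^sup>+u. ennreal (gauss_radial N (exp u)) * ennreal (exp (N * u)) \<partial>lborel)"

lemma L2_set_dilate_inverse:
  assumes "\<And>i. i \<in> I \<Longrightarrow> d i > (0::real)"
  shows "L2_set (dilate I (\<lambda>i. inverse (d i)) (dilate I d z)) I = L2_set z I"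
proof (rule L2_set_cong)
  fix i assume "i \<in> I"
  then show "dilate I (\<lambda>i. inverse (d i)) (dilate I d z) i = z i"
    using assms[of i] by (simp add: dilate_def)
qed simp

text \<open>One use of \<open>scale_exchange\<close>. On one side \<open>\<eta>\<close> is the
  Gaussian density pulled back by the inverse of \<open>D\<close>, so substituting
  \<open>D z\<close> restores the Gaussian law of \<open>z\<close>, while the ray integral of
  \<open>\<psi>\<close> averages \<open>\<phi>\<close> over the radius. On the other side the ray
  integral of \<open>\<eta>\<close> must not depend on the ray except through the scale-invariant
  weight \<open>W\<close>; this dictates the power of the norm quotient.\<close>

lemma gaussian_polar_chi:
  fixes \<phi> W :: "(nat \<Rightarrow> real) \<Rightarrow> ennreal"
  assumes "N \<ge> 1"
  defines "I \<equiv> {1..N}"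
  assumes d: "\<And>i. i \<in> I \<Longrightarrow> d i > 0"
    and [measurable]: "\<phi> \<in> borel_measurable (PiM I (\<lambda>_. borel))"
      "W \<in> borel_measurable (PiM I (\<lambda>_. borel))"
    and W: "\<And>c g. c > 0 \<Longrightarrow> W (dilate I (\<lambda>_. c) g) = W g"
  defines "D \<equiv> dilate I d" and "nr \<equiv> \<lambda>x. L2_set x I"
  shows "chi_norm N * (\<integral>\<^sup>+g. \<phi> g * W g \<partial>std_gaussian N)
    = ennreal (\<Prod>i\<in>I. d i) * (\<integral>\<^sup>+z. W (D z) * ennreal ((nr z / nr (D z)) ^ N) *
        (\<integral>\<^sup>+u. \<phi> (dilate I (\<lambda>_. exp u / nr (D z)) (D z)) *
            (ennreal (gauss_radial N (exp u)) * ennreal (exp (N * u))) \<partial>lborel) \<partial>std_gaussian N)"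
proof -
  define L where "L = PiM I (\<lambda>_. lborel :: real measure)"
  define p where "p = (\<lambda>x. ennreal (gauss_radial N (nr x)))"
  define q where "q = (\<lambda>x. nr (dilate I (\<lambda>i. inverse (d i)) x))"
  define \<psi> where "\<psi> = (\<lambda>g. \<phi> g * p g)"
  \<comment> \<open>Here \<open>q y\<close> is the norm of the preimage of \<open>y\<close> under
    \<open>D\<close>. The weight \<open>nr y ^ N\<close> from \<open>scale_exchange\<close> turns
    the N-th power of the quotient into \<open>q y ^ N\<close>, and then
    \<open>nn_integral_exp_scale\<close> yields \<open>chi_norm N\<close> on every ray.\<close>
  define \<eta> where "\<eta> = (\<lambda>y. W y * ennreal ((q y / nr y) ^ N) * p (dilate I (\<lambda>i. inverse (d i)) y))"
  have [simp]: "finite I" "card I = N" by (auto simp: I_def)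
  have nr_meas[measurable]: "nr \<in> borel_measurable (PiM I (\<lambda>_. borel))"
    unfolding nr_def by measurable
  have D_meas[measurable]: "D \<in> measurable (PiM I (\<lambda>_. borel)) (PiM I (\<lambda>_. borel))"
    unfolding D_def by measurable
  have [measurable]: "q \<in> borel_measurable (PiM I (\<lambda>_. borel))" "p \<in> borel_measurable (PiM I (\<lambda>_. borel))"
    unfolding q_def p_def by measurable
  have [measurable]: "\<psi> \<in> borel_measurable (PiM I (\<lambda>_. borel))" "\<eta> \<in> borel_measurable (PiM I (\<lambda>_. borel))"
    unfolding \<psi>_def \<eta>_def by measurable
  have sets_L[measurable_cong]: "sets L = sets (PiM I (\<lambda>_. borel))"
    unfolding L_def by (rule sets_PiM_cong) auto
  have G: "std_gaussian N = density L p"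
    by (simp only: std_gaussian_density L_def p_def nr_def I_def)
  have sets_G[measurable_cong]: "sets (std_gaussian N) = sets (PiM I (\<lambda>_. borel))"
    by (simp only: sets_std_gaussian I_def)
  have toG: "(\<integral>\<^sup>+x. p x * F x \<partial>L) = (\<integral>\<^sup>+x. F x \<partial>std_gaussian N)"
    if "F \<in> borel_measurable (PiM I (\<lambda>_. borel))" for F
    unfolding G using that by (intro nn_integral_density[symmetric]) (auto simp: measurable_cong_sets[OF sets_L refl])
  have nr_dil: "nr (dilate I (\<lambda>_. c) x) = c * nr x" if "c \<ge> 0" for c x
    using that by (simp add: nr_def L2_set_dilate_const)
  have qD: "q (D z) = nr z" for z
    using L2_set_dilate_inverse[of I d z] d by (simp add: q_def D_def nr_def)
  have nrD: "nr (D z) > 0" if "nr z > 0" for z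
  proof -
    have "nr (D z) \<noteq> 0"
    proof
      assume 0: "nr (D z) = 0"
      have "z i = 0" if "i \<in> I" for i
      proof -
        have "D z i = 0" using 0 that by (simp add: nr_def L2_set_eq_0_iff)
        then show ?thesis using that d[of i] by (simp add: D_def dilate_def)
      qed
      then have "nr z = 0" by (simp add: nr_def L2_set_eq_0_iff)
      then show False using that by simp
    qed
    then show ?thesis using L2_set_nonneg[of "D z" I] unfolding nr_def by linarith
  qed
  have AE_pos: "AE x in std_gaussian N. nr x > 0"
    using AE_std_gaussian_L2_set_pos[OF assms(1)] by (simp only: nr_def I_def)
  have curve: "(\<lambda>t. dilate I (\<lambda>_. t / r) y) \<in> measurable borel (PiM I (\<lambda>_. borel))" if "y \<in> space L" for y r
  proof -
    have [measurable]: "y \<in> space (PiM I (\<lambda>_. borel))" using that by (simp add: L_def space_PiM)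
    show ?thesis by measurable
  qed

  have "(\<integral>\<^sup>+y. \<eta> y * ennreal (nr y ^ N) * (\<integral>\<^sup>+u. \<psi> (dilate I (\<lambda>_. exp u) y) * ennreal (exp (N * u)) \<partial>lborel) \<partial>L)
    = ennreal (\<Prod>i\<in>I. d i) * (\<integral>\<^sup>+z. \<eta> (D z) * ennreal (nr (D z) ^ N) *
         (\<integral>\<^sup>+u. \<psi> (dilate I (\<lambda>_. exp u) (D z)) * ennreal (exp (N * u)) \<partial>lborel) \<partial>L)"
    unfolding L_def D_def
  proof (rule PiM_lborel_dilate[OF _ d])
    show "(\<lambda>y. \<eta> y * ennreal (nr y ^ N) *
        (\<integral>\<^sup>+u. \<psi> (dilate I (\<lambda>_. exp u) y) * ennreal (exp (N * u)) \<partial>lborel)) \<in> borel_measurable (PiM I (\<lambda>_. borel))"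
      by measurable
  qed auto
  also have "(\<integral>\<^sup>+z. \<eta> (D z) * ennreal (nr (D z) ^ N) *
         (\<integral>\<^sup>+u. \<psi> (dilate I (\<lambda>_. exp u) (D z)) * ennreal (exp (N * u)) \<partial>lborel) \<partial>L)
     = (\<integral>\<^sup>+z. p z * (W (D z) * ennreal ((nr z / nr (D z)) ^ N) * (ennreal (nr (D z) ^ N) *
         (\<integral>\<^sup>+u. \<psi> (dilate I (\<lambda>_. exp u) (D z)) * ennreal (exp (N * u)) \<partial>lborel))) \<partial>L)"
  proof (rule nn_integral_cong)
    fix z
    have "p (dilate I (\<lambda>i. inverse (d i)) (D z)) = p z"
      using qD[of z] by (simp add: p_def q_def)
    then show "\<eta> (D z) * ennreal (nr (D z) ^ N) *
         (\<integral>\<^sup>+u. \<psi> (dilate I (\<lambda>_. exp u) (D z)) * ennreal (exp (N * u)) \<partial>lborel)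
       = p z * (W (D z) * ennreal ((nr z / nr (D z)) ^ N) * (ennreal (nr (D z) ^ N) *
         (\<integral>\<^sup>+u. \<psi> (dilate I (\<lambda>_. exp u) (D z)) * ennreal (exp (N * u)) \<partial>lborel)))"
      by (simp add: \<eta>_def qD mult_ac)
  qed
  also have "\<dots> = (\<integral>\<^sup>+z. W (D z) * ennreal ((nr z / nr (D z)) ^ N) * (ennreal (nr (D z) ^ N) *
         (\<integral>\<^sup>+u. \<psi> (dilate I (\<lambda>_. exp u) (D z)) * ennreal (exp (N * u)) \<partial>lborel)) \<partial>std_gaussian N)"
    by (rule toG) measurable
  also have "\<dots> = (\<integral>\<^sup>+z. W (D z) * ennreal ((nr z / nr (D z)) ^ N) *
        (\<integral>\<^sup>+u. \<phi> (dilate I (\<lambda>_. exp u / nr (D z)) (D z)) *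
            (ennreal (gauss_radial N (exp u)) * ennreal (exp (N * u))) \<partial>lborel) \<partial>std_gaussian N)"
  proof (rule nn_integral_cong_AE, rule AE_mp[OF AE_pos], intro AE_I2 impI)
    fix z assume z: "z \<in> space (std_gaussian N)" "nr z > 0"
    then have pos: "nr (D z) > 0" by (intro nrD)
    have Dz: "D z \<in> space L" by (simp add: L_def space_PiM D_def dilate_def)
    have [measurable]: "(\<lambda>t. dilate I (\<lambda>_. t / nr (D z)) (D z)) \<in> measurable borel (PiM I (\<lambda>_. borel))"
      by (rule curve[OF Dz])
    \<comment> \<open>Translating \<open>u\<close> by \<open>ln (nr (D z))\<close> parametrises the
      ray through \<open>D z\<close> by the radius \<open>exp u\<close> itself.\<close>
    have "ennreal (nr (D z) ^ N) * (\<integral>\<^sup>+u. \<psi> (dilate I (\<lambda>_. exp u) (D z)) * ennreal (exp (N * u)) \<partial>lborel)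
      = ennreal (nr (D z) ^ N) * (\<integral>\<^sup>+u. \<psi> (dilate I (\<lambda>_. exp u * nr (D z) / nr (D z)) (D z)) * ennreal (exp (N * u)) \<partial>lborel)"
      using pos by simp
    also have "\<dots> = (\<integral>\<^sup>+u. \<psi> (dilate I (\<lambda>_. exp u / nr (D z)) (D z)) * ennreal (exp (N * u)) \<partial>lborel)"
      using pos by (intro nn_integral_exp_scale[where h="\<lambda>t. \<psi> (dilate I (\<lambda>_. t / nr (D z)) (D z))"]) measurable
    also have "\<dots> = (\<integral>\<^sup>+u. \<phi> (dilate I (\<lambda>_. exp u / nr (D z)) (D z)) *
            (ennreal (gauss_radial N (exp u)) * ennreal (exp (N * u))) \<partial>lborel)"
      using pos by (intro nn_integral_cong) (simp add: \<psi>_def p_def nr_dil mult_ac)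
    finally show "W (D z) * ennreal ((nr z / nr (D z)) ^ N) * (ennreal (nr (D z) ^ N) *
         (\<integral>\<^sup>+u. \<psi> (dilate I (\<lambda>_. exp u) (D z)) * ennreal (exp (N * u)) \<partial>lborel))
       = W (D z) * ennreal ((nr z / nr (D z)) ^ N) *
        (\<integral>\<^sup>+u. \<phi> (dilate I (\<lambda>_. exp u / nr (D z)) (D z)) *
            (ennreal (gauss_radial N (exp u)) * ennreal (exp (N * u))) \<partial>lborel)"
      by simp
  qed
  finally have lhs: "(\<integral>\<^sup>+y. \<eta> y * ennreal (nr y ^ N) * (\<integral>\<^sup>+u. \<psi> (dilate I (\<lambda>_. exp u) y) * ennreal (exp (N * u)) \<partial>lborel) \<partial>L)
    = ennreal (\<Prod>i\<in>I. d i) * (\<integral>\<^sup>+z. W (D z) * ennreal ((nr z / nr (D z)) ^ N) *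
        (\<integral>\<^sup>+u. \<phi> (dilate I (\<lambda>_. exp u / nr (D z)) (D z)) *
            (ennreal (gauss_radial N (exp u)) * ennreal (exp (N * u))) \<partial>lborel) \<partial>std_gaussian N)" .

  have "(\<integral>\<^sup>+y. \<psi> y * ennreal (nr y ^ N) * (\<integral>\<^sup>+u. \<eta> (dilate I (\<lambda>_. exp u) y) * ennreal (exp (N * u)) \<partial>lborel) \<partial>L)
    = (\<integral>\<^sup>+y. p y * (\<phi> y * (ennreal (nr y ^ N) * (\<integral>\<^sup>+u. \<eta> (dilate I (\<lambda>_. exp u) y) * ennreal (exp (N * u)) \<partial>lborel))) \<partial>L)"
    by (simp add: \<psi>_def mult_ac)
  also have "\<dots> = (\<integral>\<^sup>+y. \<phi> y * (ennreal (nr y ^ N) * (\<integral>\<^sup>+u. \<eta> (dilate I (\<lambda>_. exp u) y) * ennreal (exp (N * u)) \<partial>lborel)) \<partial>std_gaussian N)"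
    by (rule toG) measurable
  also have "\<dots> = (\<integral>\<^sup>+y. chi_norm N * (\<phi> y * W y) \<partial>std_gaussian N)"
  proof (rule nn_integral_cong_AE, rule AE_mp[OF AE_pos], intro AE_I2 impI)
    fix y assume y: "y \<in> space (std_gaussian N)" "nr y > 0"
    have "D (dilate I (\<lambda>i. inverse (d i)) y) = y"
    proof (rule ext)
      fix i show "D (dilate I (\<lambda>i. inverse (d i)) y) i = y i"
        using y(1) d[of i] by (cases "i \<in> I") (auto simp: D_def dilate_def space_std_gaussian I_def)
    qed
    have qpos: "q y > 0"
    proof -
      have "q y \<noteq> 0"
      proof
        assume 0: "q y = 0"
        have "y i = 0" if "i \<in> I" for i
          using 0 that d[OF that] by (fastforce simp: q_def nr_def L2_set_eq_0_iff dilate_def)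
        then have "nr y = 0" by (simp add: nr_def L2_set_eq_0_iff)
        then show False using y(2) by simp
      qed
      then show ?thesis
        using L2_set_nonneg[of "dilate I (\<lambda>i. inverse (d i)) y" I] unfolding q_def nr_def by linarith
    qed
    have q_dil: "q (dilate I (\<lambda>_. c) y) = c * q y" if "c \<ge> 0" for c
    proof -
      have "dilate I (\<lambda>i. inverse (d i)) (dilate I (\<lambda>_. c) y) = dilate I (\<lambda>_. c) (dilate I (\<lambda>i. inverse (d i)) y)"
        by (simp add: dilate_dilate mult_ac)
      then show ?thesis using that by (simp add: q_def nr_dil)
    qed
    have "(\<integral>\<^sup>+u. \<eta> (dilate I (\<lambda>_. exp u) y) * ennreal (exp (N * u)) \<partial>lborel)
      = (\<integral>\<^sup>+u. (W y * ennreal ((q y / nr y) ^ N)) * (ennreal (gauss_radial N (exp u * q y)) * ennreal (exp (N * u))) \<partial>lborel)"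
    proof (rule nn_integral_cong)
      fix u :: real
      have "\<eta> (dilate I (\<lambda>_. exp u) y) = W y * ennreal ((q y / nr y) ^ N) * ennreal (gauss_radial N (exp u * q y))"
      proof -
        have "W (dilate I (\<lambda>_. exp u) y) = W y" using W[of "exp u" y] by simp
        moreover have "p (dilate I (\<lambda>i. inverse (d i)) (dilate I (\<lambda>_. exp u) y)) = ennreal (gauss_radial N (exp u * q y))"
          using q_dil[of "exp u"] by (simp add: p_def q_def)
        ultimately show ?thesis by (simp add: \<eta>_def q_dil nr_dil)
      qed
      then show "\<eta> (dilate I (\<lambda>_. exp u) y) * ennreal (exp (N * u))
        = (W y * ennreal ((q y / nr y) ^ N)) * (ennreal (gauss_radial N (exp u * q y)) * ennreal (exp (N * u)))"
        by (simp add: mult_ac)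
    qed
    also have "\<dots> = W y * ennreal ((q y / nr y) ^ N) * (\<integral>\<^sup>+u. ennreal (gauss_radial N (exp u * q y)) * ennreal (exp (N * u)) \<partial>lborel)"
      by (rule nn_integral_cmult) measurable
    finally have "ennreal (nr y ^ N) * (\<integral>\<^sup>+u. \<eta> (dilate I (\<lambda>_. exp u) y) * ennreal (exp (N * u)) \<partial>lborel)
      = W y * ((ennreal (nr y ^ N) * ennreal ((q y / nr y) ^ N)) * (\<integral>\<^sup>+u. ennreal (gauss_radial N (exp u * q y)) * ennreal (exp (N * u)) \<partial>lborel))"
      by (simp add: mult_ac)
    also have "ennreal (nr y ^ N) * ennreal ((q y / nr y) ^ N) = ennreal (q y ^ N)"
      using y(2) qpos by (subst ennreal_mult[symmetric]) (auto simp: power_divide)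
    also have "ennreal (q y ^ N) * (\<integral>\<^sup>+u. ennreal (gauss_radial N (exp u * q y)) * ennreal (exp (N * u)) \<partial>lborel) = chi_norm N"
      unfolding chi_norm_def using qpos
      by (intro nn_integral_exp_scale[where h="\<lambda>t. ennreal (gauss_radial N t)"]) auto
    finally show "\<phi> y * (ennreal (nr y ^ N) * (\<integral>\<^sup>+u. \<eta> (dilate I (\<lambda>_. exp u) y) * ennreal (exp (N * u)) \<partial>lborel))
      = chi_norm N * (\<phi> y * W y)" by (simp add: mult_ac)
  qed
  also have "\<dots> = chi_norm N * (\<integral>\<^sup>+y. \<phi> y * W y \<partial>std_gaussian N)"
    by (rule nn_integral_cmult) measurable
  finally have rhs: "(\<integral>\<^sup>+y. \<psi> y * ennreal (nr y ^ N) * (\<integral>\<^sup>+u. \<eta> (dilate I (\<lambda>_. exp u) y) * ennreal (exp (N * u)) \<partial>lborel) \<partial>L)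
    = chi_norm N * (\<integral>\<^sup>+y. \<phi> y * W y \<partial>std_gaussian N)" .
  have "(\<integral>\<^sup>+y. \<eta> y * ennreal (nr y ^ N) * (\<integral>\<^sup>+u. \<psi> (dilate I (\<lambda>_. exp u) y) * ennreal (exp (N * u)) \<partial>lborel) \<partial>L)
    = (\<integral>\<^sup>+y. \<psi> y * ennreal (nr y ^ N) * (\<integral>\<^sup>+u. \<eta> (dilate I (\<lambda>_. exp u) y) * ennreal (exp (N * u)) \<partial>lborel) \<partial>L)"
    using scale_exchange[of I \<psi> \<eta>] by (simp add: nr_def L_def)
  then show ?thesis unfolding lhs rhs by simp
qed

text \<open>The case of \<open>gaussian_polar_chi\<close> with \<open>d\<close> and \<open>W\<close>
  constantly 1, where the inner integral is the same for almost all \<open>z\<close>. Read from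
  right to left it turns an integral over radii into a mean over the norm of a Gaussian
  vector.\<close>

lemma chi_norm_radial:
  assumes "N \<ge> 1" and [measurable]: "\<psi> \<in> borel_measurable borel"
  shows "chi_norm N * (\<integral>\<^sup>+x. \<psi> (L2_set x {1..N}) \<partial>std_gaussian N)
    = (\<integral>\<^sup>+u. \<psi> (exp u) * (ennreal (gauss_radial N (exp u)) * ennreal (exp (N * u))) \<partial>lborel)"
proof -
  interpret prob_space "std_gaussian N" by (rule prob_space_std_gaussian)
  let ?I = "{1..N}"
  have "chi_norm N * (\<integral>\<^sup>+x. \<psi> (L2_set x ?I) * 1 \<partial>std_gaussian N)
    = ennreal (\<Prod>i\<in>?I. 1) * (\<integral>\<^sup>+z. 1 * ennreal ((L2_set z ?I / L2_set (dilate ?I (\<lambda>_. 1) z) ?I) ^ N) *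
        (\<integral>\<^sup>+u. \<psi> (L2_set (dilate ?I (\<lambda>_. exp u / L2_set (dilate ?I (\<lambda>_. 1) z) ?I) (dilate ?I (\<lambda>_. 1) z)) ?I) *
            (ennreal (gauss_radial N (exp u)) * ennreal (exp (N * u))) \<partial>lborel) \<partial>std_gaussian N)"
    by (rule gaussian_polar_chi) (use assms in auto)
  also have "\<dots> = (\<integral>\<^sup>+z. (\<integral>\<^sup>+u. \<psi> (exp u) * (ennreal (gauss_radial N (exp u)) * ennreal (exp (N * u))) \<partial>lborel) \<partial>std_gaussian N)"
    unfolding prod.neutral_const ennreal_1 mult_1
  proof (rule nn_integral_cong_AE, rule AE_mp[OF AE_std_gaussian_L2_set_pos[OF assms(1)]], intro AE_I2 impI)
    fix z assume pos: "0 < L2_set z ?I"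
    have 1: "L2_set (dilate ?I (\<lambda>_. 1) z) ?I = L2_set z ?I" by (subst L2_set_dilate_const) auto
    have 2: "L2_set (dilate ?I (\<lambda>_. exp u / L2_set z ?I) (dilate ?I (\<lambda>_. 1) z)) ?I = exp u" for u
      using pos 1 by (subst L2_set_dilate_const) auto
    show "ennreal ((L2_set z ?I / L2_set (dilate ?I (\<lambda>_. 1) z) ?I) ^ N) *
        (\<integral>\<^sup>+u. \<psi> (L2_set (dilate ?I (\<lambda>_. exp u / L2_set (dilate ?I (\<lambda>_. 1) z) ?I) (dilate ?I (\<lambda>_. 1) z)) ?I) *
            (ennreal (gauss_radial N (exp u)) * ennreal (exp (N * u))) \<partial>lborel)
       = (\<integral>\<^sup>+u. \<psi> (exp u) * (ennreal (gauss_radial N (exp u)) * ennreal (exp (N * u))) \<partial>lborel)"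
      unfolding 1 2 using pos by simp
  qed
  also have "\<dots> = (\<integral>\<^sup>+u. \<psi> (exp u) * (ennreal (gauss_radial N (exp u)) * ennreal (exp (N * u))) \<partial>lborel)"
    by (simp add: emeasure_space_1)
  finally show ?thesis by simp
qed

lemma chi_norm_pos: "chi_norm N \<noteq> 0"
proof
  assume "chi_norm N = 0"
  then have "AE u in lborel. ennreal (gauss_radial N (exp u)) * ennreal (exp (N * u)) = 0"
    unfolding chi_norm_def by (subst (asm) nn_integral_0_iff_AE) auto
  moreover have "ennreal (gauss_radial N (exp u)) * ennreal (exp (N * u)) \<noteq> 0" for u :: real
    using gauss_radial_pos[of N "exp u"] by (auto simp: ennreal_eq_0_iff not_le)
  ultimately have "AE u::real in lborel. False" by simp
  then show False by (simp add: eventually_False ae_filter_eq_bot_iff)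
qed

text \<open>The radial test function is chosen so that the right-hand side of the previous identity
  becomes a Gaussian integral in \<open>u\<close>.\<close>

lemma chi_norm_finite:
  assumes "N \<ge> 1"
  shows "chi_norm N < \<infinity>"
proof -
  interpret prob_space "std_gaussian N" by (rule prob_space_std_gaussian)
  define \<psi> where "\<psi> r = ennreal (std_normal_density (ln r) / (gauss_radial N r * exp (N * ln r)))" for r
  have [measurable]: "\<psi> \<in> borel_measurable borel" unfolding \<psi>_def by measurable
  have pos: "\<psi> r \<noteq> 0" for r
    using gauss_radial_pos[of N r] by (auto simp: \<psi>_def ennreal_eq_0_iff not_le normal_density_pos)
  have "(\<integral>\<^sup>+x. \<psi> (L2_set x {1..N}) \<partial>std_gaussian N) \<noteq> 0"
    by (subst nn_integral_0_iff_AE, measurable, simp add: pos)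
  moreover have "chi_norm N * (\<integral>\<^sup>+x. \<psi> (L2_set x {1..N}) \<partial>std_gaussian N) = 1"
  proof -
    have "chi_norm N * (\<integral>\<^sup>+x. \<psi> (L2_set x {1..N}) \<partial>std_gaussian N)
      = (\<integral>\<^sup>+u. \<psi> (exp u) * (ennreal (gauss_radial N (exp u)) * ennreal (exp (N * u))) \<partial>lborel)"
      using assms by (intro chi_norm_radial) auto
    also have "\<dots> = (\<integral>\<^sup>+u. ennreal (std_normal_density u) \<partial>lborel)"
    proof (rule nn_integral_cong)
      fix u :: real
      show "\<psi> (exp u) * (ennreal (gauss_radial N (exp u)) * ennreal (exp (N * u))) = ennreal (std_normal_density u)"
        using gauss_radial_pos[of N "exp u"]
        by (simp add: \<psi>_def ennreal_mult[symmetric])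
    qed
    also have "\<dots> = emeasure std_normal (space std_normal)"
      by (simp add: emeasure_density)
    also have "\<dots> = 1" using prob_space.emeasure_space_1[OF prob_space_std_normal] .
    finally show ?thesis .
  qed
  \<comment> \<open>An infinite \<open>chi_norm N\<close> times a nonzero factor would be infinite,
    not 1.\<close>
  ultimately show ?thesis
    by (metis ennreal_mult_eq_top_iff ennreal_one_neq_top infinity_ennreal_def less_top)
qed

text \<open>By \<open>chi_norm_radial\<close> the radius becomes the norm of an independent Gaussian
  vector \<open>x\<close>. Both sides then carry the factor \<open>chi_norm N\<close>, which cancels
  because it is neither 0 nor infinite.\<close>

lemma gaussian_polar:
  fixes \<phi> W :: "(nat \<Rightarrow> real) \<Rightarrow> ennreal"
  assumes "N \<ge> 1"
  defines "I \<equiv> {1..N}"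
  assumes d: "\<And>i. i \<in> I \<Longrightarrow> d i > 0"
    and [measurable]: "\<phi> \<in> borel_measurable (PiM I (\<lambda>_. borel))"
      "W \<in> borel_measurable (PiM I (\<lambda>_. borel))"
    and W: "\<And>c g. c > 0 \<Longrightarrow> W (dilate I (\<lambda>_. c) g) = W g"
  defines "D \<equiv> dilate I d" and "nr \<equiv> \<lambda>x. L2_set x I"
  shows "(\<integral>\<^sup>+g. \<phi> g * W g \<partial>std_gaussian N)
    = ennreal (\<Prod>i\<in>I. d i) * (\<integral>\<^sup>+z. W (D z) * ennreal ((nr z / nr (D z)) ^ N) *
        (\<integral>\<^sup>+x. \<phi> (dilate I (\<lambda>_. nr x / nr (D z)) (D z)) \<partial>std_gaussian N) \<partial>std_gaussian N)"
proof -
  have sets_G[measurable_cong]: "sets (std_gaussian N) = sets (PiM I (\<lambda>_. borel))"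
    by (simp only: sets_std_gaussian I_def)
  interpret prob_space "std_gaussian N" by (rule prob_space_std_gaussian)
  have nr_meas[measurable]: "nr \<in> borel_measurable (PiM I (\<lambda>_. borel))"
    unfolding nr_def by measurable
  have D_meas[measurable]: "D \<in> measurable (PiM I (\<lambda>_. borel)) (PiM I (\<lambda>_. borel))"
    unfolding D_def by measurable
  have "chi_norm N * (\<integral>\<^sup>+g. \<phi> g * W g \<partial>std_gaussian N)
    = ennreal (\<Prod>i\<in>I. d i) * (\<integral>\<^sup>+z. W (D z) * ennreal ((nr z / nr (D z)) ^ N) *
        (\<integral>\<^sup>+u. \<phi> (dilate I (\<lambda>_. exp u / nr (D z)) (D z)) *
            (ennreal (gauss_radial N (exp u)) * ennreal (exp (N * u))) \<partial>lborel) \<partial>std_gaussian N)"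
    unfolding D_def nr_def I_def
    by (rule gaussian_polar_chi) (use assms in \<open>auto simp: I_def\<close>)
  also have "\<dots> = ennreal (\<Prod>i\<in>I. d i) * (\<integral>\<^sup>+z. chi_norm N * (W (D z) * ennreal ((nr z / nr (D z)) ^ N) *
        (\<integral>\<^sup>+x. \<phi> (dilate I (\<lambda>_. nr x / nr (D z)) (D z)) \<partial>std_gaussian N)) \<partial>std_gaussian N)"
  proof (rule arg_cong2[where f="(*)", OF refl], rule nn_integral_cong)
    fix z
    have [measurable]: "D z \<in> space (PiM I (\<lambda>_. borel))" by (simp add: space_PiM D_def dilate_def)
    have "chi_norm N * (\<integral>\<^sup>+x. \<phi> (dilate I (\<lambda>_. L2_set x {1..N} / nr (D z)) (D z)) \<partial>std_gaussian N)
      = (\<integral>\<^sup>+u. \<phi> (dilate I (\<lambda>_. exp u / nr (D z)) (D z)) *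
            (ennreal (gauss_radial N (exp u)) * ennreal (exp (N * u))) \<partial>lborel)"
      using assms(1) by (rule chi_norm_radial) measurable
    then have eq: "(\<integral>\<^sup>+u. \<phi> (dilate I (\<lambda>_. exp u / nr (D z)) (D z)) *
            (ennreal (gauss_radial N (exp u)) * ennreal (exp (N * u))) \<partial>lborel)
      = chi_norm N * (\<integral>\<^sup>+x. \<phi> (dilate I (\<lambda>_. nr x / nr (D z)) (D z)) \<partial>std_gaussian N)"
      by (simp only: nr_def I_def)
    show "W (D z) * ennreal ((nr z / nr (D z)) ^ N) * (\<integral>\<^sup>+u. \<phi> (dilate I (\<lambda>_. exp u / nr (D z)) (D z)) *
            (ennreal (gauss_radial N (exp u)) * ennreal (exp (N * u))) \<partial>lborel)
       = chi_norm N * (W (D z) * ennreal ((nr z / nr (D z)) ^ N) *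
        (\<integral>\<^sup>+x. \<phi> (dilate I (\<lambda>_. nr x / nr (D z)) (D z)) \<partial>std_gaussian N))"
      unfolding eq by (simp only: mult_ac)
  qed
  also have "\<dots> = chi_norm N * (ennreal (\<Prod>i\<in>I. d i) * (\<integral>\<^sup>+z. W (D z) * ennreal ((nr z / nr (D z)) ^ N) *
        (\<integral>\<^sup>+x. \<phi> (dilate I (\<lambda>_. nr x / nr (D z)) (D z)) \<partial>std_gaussian N) \<partial>std_gaussian N))"
    by (subst nn_integral_cmult) (auto simp: mult_ac)
  finally show ?thesis
    using chi_norm_pos[of N] chi_norm_finite[OF assms(1)] by (auto simp: ennreal_mult_cancel_left)
qed

section \<open>Sums of independent functions\<close>

lemma std_gaussian_sum_sq:
  fixes u :: "nat \<Rightarrow> real \<Rightarrow> real"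
  assumes int: "\<And>i. i \<in> {1..N} \<Longrightarrow> integrable std_normal (u i)"
    and mean: "\<And>i. i \<in> {1..N} \<Longrightarrow> (\<integral>x. u i x \<partial>std_normal) = 0"
    and sq: "\<And>i. i \<in> {1..N} \<Longrightarrow> integrable std_normal (\<lambda>x. (u i x)\<^sup>2)"
  shows "integrable (std_gaussian N) (\<lambda>z. (\<Sum>i\<in>{1..N}. u i (z i))\<^sup>2)"
    and "(\<integral>z. (\<Sum>i\<in>{1..N}. u i (z i))\<^sup>2 \<partial>std_gaussian N) = (\<Sum>i\<in>{1..N}. \<integral>x. (u i x)\<^sup>2 \<partial>std_normal)"
proof -
  define I where "I = {1..N}"
  have [simp]: "finite I" by (simp add: I_def)
  interpret S: prob_space std_normal by (rule prob_space_std_normal)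
  interpret product_sigma_finite "\<lambda>_::nat. std_normal"
    by (simp add: product_sigma_finite_def S.sigma_finite_measure_axioms)
  have *: "integrable (std_gaussian N) (\<lambda>z. u i (z i) * u j (z j))"
    "(\<integral>z. u i (z i) * u j (z j) \<partial>std_gaussian N) = (if i = j then \<integral>x. (u i x)\<^sup>2 \<partial>std_normal else 0)"
    if ij: "i \<in> I" "j \<in> I" for i j
  proof -
    \<comment> \<open>Padding with factors 1 writes the term of the double sum as a product over all
      coordinates, so that the product rule applies; the case \<open>i = j\<close>, where both
      factors fall on one coordinate, is included.\<close>
    define v where "v k x = (if k = i then u i x else 1) * (if k = j then u j x else 1)" for k x
    have prod_v: "(\<Prod>k\<in>I. v k (z k)) = u i (z i) * u j (z j)" for z
      using ij by (simp add: v_def prod.distrib)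
    have int_v: "integrable std_normal (v k)" if "k \<in> I" for k
    proof -
      have "v k = (if k = i then (if k = j then (\<lambda>x. (u i x)\<^sup>2) else u i) else (if k = j then u j else (\<lambda>_. 1)))"
        by (auto simp: v_def power2_eq_square fun_eq_iff)
      then show ?thesis
        using int[of i] int[of j] sq[of i] ij by (auto simp: I_def)
    qed
    show "integrable (std_gaussian N) (\<lambda>z. u i (z i) * u j (z j))"
      unfolding prod_v[symmetric] std_gaussian_def I_def[symmetric]
      by (rule product_integrable_prod) (auto intro: int_v)
    have "(\<integral>z. u i (z i) * u j (z j) \<partial>std_gaussian N) = (\<Prod>k\<in>I. integral\<^sup>L std_normal (v k))"
      unfolding prod_v[symmetric] std_gaussian_def I_def[symmetric]
      by (rule product_integral_prod) (auto intro: int_v)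
    also have "\<dots> = (if i = j then \<integral>x. (u i x)\<^sup>2 \<partial>std_normal else 0)"
    proof (cases "i = j")
      case True
      have "integral\<^sup>L std_normal (v k) = (if k = i then \<integral>x. (u i x)\<^sup>2 \<partial>std_normal else 1)" for k
      proof (cases "k = i")
        case k: True
        then have "v k = (\<lambda>x. (u i x)\<^sup>2)" using True by (simp add: v_def power2_eq_square fun_eq_iff)
        then show ?thesis using k by simp
      next
        case k: False
        then have "v k = (\<lambda>x. 1)" using True by (simp add: v_def fun_eq_iff)
        then show ?thesis using k S.prob_space by simp
      qed
      then show ?thesis using True ij by simp
    next
      case False
      then have "v i = u i" by (simp add: v_def fun_eq_iff)
      then have "integral\<^sup>L std_normal (v i) = 0" using mean ij by (simp add: I_def)
      then have "(\<Prod>k\<in>I. integral\<^sup>L std_normal (v k)) = 0" using ij by (intro prod_zero) auto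
      then show ?thesis using False by simp
    qed
    finally show "(\<integral>z. u i (z i) * u j (z j) \<partial>std_gaussian N) = (if i = j then \<integral>x. (u i x)\<^sup>2 \<partial>std_normal else 0)" .
  qed
  have expand: "(\<Sum>i\<in>I. u i (z i))\<^sup>2 = (\<Sum>i\<in>I. \<Sum>j\<in>I. u i (z i) * u j (z j))" for z
    by (simp add: power2_eq_square sum_product)
  show "integrable (std_gaussian N) (\<lambda>z. (\<Sum>i\<in>{1..N}. u i (z i))\<^sup>2)"
    unfolding I_def[symmetric] expand by (intro Bochner_Integration.integrable_sum *)
  have "(\<integral>z. (\<Sum>i\<in>I. u i (z i))\<^sup>2 \<partial>std_gaussian N) = (\<Sum>i\<in>I. \<Sum>j\<in>I. \<integral>z. u i (z i) * u j (z j) \<partial>std_gaussian N)"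
    unfolding expand using * by (subst Bochner_Integration.integral_sum, force)+ simp
  also have "\<dots> = (\<Sum>i\<in>I. \<integral>x. (u i x)\<^sup>2 \<partial>std_normal)"
    by (intro sum.cong refl) (simp add: * )
  finally show "(\<integral>z. (\<Sum>i\<in>{1..N}. u i (z i))\<^sup>2 \<partial>std_gaussian N) = (\<Sum>i\<in>{1..N}. \<integral>x. (u i x)\<^sup>2 \<partial>std_normal)"
    unfolding I_def .
qed

lemma std_normal_moments:
  shows "integrable std_normal (\<lambda>x. x ^ k)"
    and "(\<integral>x. x \<partial>std_normal) = 0" and "(\<integral>x. x\<^sup>2 \<partial>std_normal) = 1" and "(\<integral>x. x ^ 4 \<partial>std_normal) = 3"
proof -
  have *: "(\<integral>x. x ^ k \<partial>std_normal) = (\<integral>x. std_normal_density x * x ^ k \<partial>lborel)" for k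
    by (subst integral_density) (auto simp: normal_density_nonneg)
  show "integrable std_normal (\<lambda>x. x ^ k)"
    using integrable_std_normal_moment[of k]
    by (subst integrable_density) (auto simp: normal_density_nonneg)
  show "(\<integral>x. x \<partial>std_normal) = 0"
    using *[of 1] integral_std_normal_moment_odd[of 0] by simp
  show "(\<integral>x. x\<^sup>2 \<partial>std_normal) = 1"
    using *[of 2] integral_std_normal_moment_even[of 1] by simp
  show "(\<integral>x. x ^ 4 \<partial>std_normal) = 3"
    using *[of 4] integral_std_normal_moment_even[of 2] by (simp add: fact_numeral)
qed

lemma std_normal_square_centred:
  shows "integrable std_normal (\<lambda>x. x\<^sup>2 - 1)" "(\<integral>x. x\<^sup>2 - 1 \<partial>std_normal) = 0"
    "integrable std_normal (\<lambda>x. (x\<^sup>2 - 1)\<^sup>2)" "(\<integral>x. (x\<^sup>2 - 1)\<^sup>2 \<partial>std_normal) = 2"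
proof -
  interpret S: prob_space std_normal by (rule prob_space_std_normal)
  note m = std_normal_moments
  have e: "(x\<^sup>2 - 1)\<^sup>2 = x ^ 4 - 2 * x\<^sup>2 + 1" for x :: real
    by (simp add: power2_eq_square power4_eq_xxxx algebra_simps)
  show "integrable std_normal (\<lambda>x. x\<^sup>2 - 1)" using m(1)[of 2] by auto
  show "(\<integral>x. x\<^sup>2 - 1 \<partial>std_normal) = 0"
    using m(1)[of 2] m(3) S.prob_space by (subst Bochner_Integration.integral_diff) auto
  show "integrable std_normal (\<lambda>x. (x\<^sup>2 - 1)\<^sup>2)"
    unfolding e using m(1)[of 2] m(1)[of 4] by auto
  have "(\<integral>x. x ^ 4 - 2 * x\<^sup>2 + 1 \<partial>std_normal) = (\<integral>x. x ^ 4 \<partial>std_normal) - 2 * (\<integral>x. x\<^sup>2 \<partial>std_normal) + 1"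
    using m(1)[of 2] m(1)[of 4] S.prob_space by simp
  then show "(\<integral>x. (x\<^sup>2 - 1)\<^sup>2 \<partial>std_normal) = 2"
    unfolding e using m by simp
qed

lemma weighted_chi_square_variance:
  fixes c :: "nat \<Rightarrow> real"
  shows "integrable (std_gaussian N) (\<lambda>z. (\<Sum>i\<in>{1..N}. c i * ((z i)\<^sup>2 - 1))\<^sup>2)"
    and "(\<integral>z. (\<Sum>i\<in>{1..N}. c i * ((z i)\<^sup>2 - 1))\<^sup>2 \<partial>std_gaussian N) = 2 * (\<Sum>i\<in>{1..N}. (c i)\<^sup>2)"
  using std_normal_square_centred
    std_gaussian_sum_sq[of N "\<lambda>i x. c i * (x\<^sup>2 - 1)"]
  by (auto simp: power_mult_distrib sum_distrib_left mult_ac)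

section \<open>Comparison of the Gibbs measure with a product measure\<close>

lemma hamiltonian_eq: "hamiltonian N a g = N * (\<Sum>i\<in>{1..N}. a i * (g i)\<^sup>2) / (L2_set g {1..N})\<^sup>2"
  by (simp only: hamiltonian_def sum_divide_distrib[symmetric] times_divide_eq_right)

lemma hamiltonian_dilate:
  assumes "c > 0"
  shows "hamiltonian N a (dilate {1..N} (\<lambda>_. c) g) = hamiltonian N a g"
proof -
  have "(\<Sum>i\<in>{1..N}. a i * (dilate {1..N} (\<lambda>_. c) g i)\<^sup>2) = c\<^sup>2 * (\<Sum>i\<in>{1..N}. a i * (g i)\<^sup>2)"
    by (simp add: dilate_def power_mult_distrib sum_distrib_left mult_ac)
  then show ?thesis
    using assms by (simp only: hamiltonian_eq L2_set_dilate_const less_imp_le power_mult_distrib) simp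
qed

lemma measurable_hamiltonian [measurable]:
  "hamiltonian N a \<in> borel_measurable (PiM {1..N} (\<lambda>_. borel))"
  unfolding hamiltonian_eq by measurable

lemma L2_set_sq: "(L2_set x I)\<^sup>2 = (\<Sum>i\<in>I. (x i)\<^sup>2)"
  by (simp add: L2_set_def sum_nonneg)

text \<open>The bound \<open>small\<close> keeps the variances in a fixed compact subset of the
  positive reals, independent of \<open>N\<close>; \<open>normalised\<close> makes their mean
  1.\<close>

locale tilted_gaussian =
  fixes N :: nat and a :: "nat \<Rightarrow> real" and \<theta> w :: real
  assumes N: "N \<ge> 1"
    and small: "\<And>i. i \<in> {1..N} \<Longrightarrow> \<bar>2 * \<theta> * (w - a i)\<bar> \<le> 1 / 2"
    and normalised: "(\<Sum>i\<in>{1..N}. 1 / (1 + 2 * \<theta> * (w - a i))) = N"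
begin

definition s where "s i = 1 / (1 + 2 * \<theta> * (w - a i))"
definition D where "D = dilate {1..N} (\<lambda>i. sqrt (s i))"
definition nr where "nr x = L2_set x {1..N}"

text \<open>Up to a constant, \<open>density_ratio z\<close> is the density of the Gibbs law of the direction
  \<open>g / |g|\<close> with respect to the law of the direction of \<open>D z\<close>, at the direction of \<open>D z\<close>.\<close>
definition excess where "excess z = (nr z)\<^sup>2 / (nr (D z))\<^sup>2 - 1"
definition density_ratio where "density_ratio z = exp (- (N / 2) * (excess z - ln (1 + excess z)))"

lemma denom: "i \<in> {1..N} \<Longrightarrow> 1 / 2 \<le> 1 + 2 * \<theta> * (w - a i)" "i \<in> {1..N} \<Longrightarrow> 1 + 2 * \<theta> * (w - a i) \<le> 3 / 2"
  using small[of i] by linarith+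

lemma s_bounds: "i \<in> {1..N} \<Longrightarrow> 0 < s i" "i \<in> {1..N} \<Longrightarrow> s i \<le> 2" "i \<in> {1..N} \<Longrightarrow> 2 / 3 \<le> s i"
  using denom[of i] by (auto simp: s_def field_simps)

lemma sum_s: "(\<Sum>i\<in>{1..N}. s i) = N"
  using normalised by (simp add: s_def)

lemma D_apply: "i \<in> {1..N} \<Longrightarrow> D z i = sqrt (s i) * z i"
  by (simp add: D_def dilate_def)

lemma nr_D_sq: "(nr (D z))\<^sup>2 = (\<Sum>i\<in>{1..N}. s i * (z i)\<^sup>2)"
  unfolding nr_def L2_set_sq
  by (rule sum.cong) (use s_bounds in \<open>auto simp: D_apply power_mult_distrib less_imp_le\<close>)

lemma nr_sq: "(nr z)\<^sup>2 = (\<Sum>i\<in>{1..N}. (z i)\<^sup>2)"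
  by (simp add: nr_def L2_set_sq)

lemma nr_sq_D: "(nr z)\<^sup>2 = (\<Sum>i\<in>{1..N}. (1 + 2 * \<theta> * (w - a i)) * (D z i)\<^sup>2)"
  unfolding nr_sq
proof (rule sum.cong)
  fix i assume i: "i \<in> {1..N}"
  then show "(z i)\<^sup>2 = (1 + 2 * \<theta> * (w - a i)) * (D z i)\<^sup>2"
    using s_bounds(1)[OF i] denom(1)[OF i] by (simp add: D_apply power_mult_distrib) (simp add: s_def)
qed simp

lemma nr_D_pos:
  assumes "nr z > 0"
  shows "nr (D z) > 0"
proof -
  have "(nr z)\<^sup>2 \<le> (\<Sum>i\<in>{1..N}. 3 / 2 * (D z i)\<^sup>2)"
    unfolding nr_sq_D using denom by (intro sum_mono mult_right_mono) auto
  also have "\<dots> = 3 / 2 * (nr (D z))\<^sup>2" by (simp only: nr_sq sum_distrib_left)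
  finally have "(nr (D z))\<^sup>2 \<noteq> 0" using assms zero_less_power[of "nr z" 2] by linarith
  then show ?thesis using L2_set_nonneg[of "D z" "{1..N}"] by (simp add: nr_def less_le)
qed

text \<open>By \<open>nr_sq_D\<close>, \<open>1 + excess z\<close> is the average of the numbers
  \<open>1 + 2 * \<theta> * (w - a i)\<close> with weights proportional to
  \<open>(D z i)\<^sup>2\<close>, so it lies between their bounds.\<close>

lemma excess_bound:
  assumes "nr z > 0"
  shows "\<bar>excess z\<bar> \<le> 1 / 2"
proof -
  have pos: "(nr (D z))\<^sup>2 > 0" using nr_D_pos[OF assms] by simp
  have "(nr z)\<^sup>2 \<le> (\<Sum>i\<in>{1..N}. 3 / 2 * (D z i)\<^sup>2)"
    unfolding nr_sq_D using denom by (intro sum_mono mult_right_mono) auto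
  then have u: "(nr z)\<^sup>2 \<le> 3 / 2 * (nr (D z))\<^sup>2" by (simp only: nr_sq sum_distrib_left)
  have "(\<Sum>i\<in>{1..N}. 1 / 2 * (D z i)\<^sup>2) \<le> (nr z)\<^sup>2"
    unfolding nr_sq_D using denom by (intro sum_mono mult_right_mono) auto
  then have l: "1 / 2 * (nr (D z))\<^sup>2 \<le> (nr z)\<^sup>2" by (simp only: nr_sq sum_distrib_left)
  have "excess z \<le> 1 / 2" "- (1 / 2) \<le> excess z"
    using pos u l by (auto simp: excess_def field_simps)
  then show ?thesis by linarith
qed

text \<open>By \<open>nr_sq_D\<close> the quotient of the squared norms of \<open>z\<close> and
  \<open>D z\<close> is an affine function of the energy of \<open>D z\<close>: twice
  \<open>\<theta>\<close> times the energy is \<open>N * (2 * \<theta> * w - excess z)\<close>. The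
  Gibbs weight therefore contributes \<open>exp (- N / 2 * excess z)\<close>, and the power of the
  norm quotient contributes \<open>(1 + excess z)\<close> to the power \<open>N / 2\<close>.\<close>

lemma gibbs_weight_D:
  assumes "nr z > 0"
  shows "exp (\<theta> * hamiltonian N a (D z)) * (nr z / nr (D z)) ^ N = exp (N * \<theta> * w) * density_ratio z"
proof -
  have pos: "nr (D z) > 0" by (rule nr_D_pos[OF assms])
  have "(nr z)\<^sup>2 = (1 + 2 * \<theta> * w) * (nr (D z))\<^sup>2 - 2 * \<theta> * (\<Sum>i\<in>{1..N}. a i * (D z i)\<^sup>2)"
    unfolding nr_sq_D[of z] nr_sq[of "D z"] sum_distrib_left sum_subtractf[symmetric]
    by (rule sum.cong) (auto simp: algebra_simps)
  then have q: "2 * \<theta> * ((\<Sum>i\<in>{1..N}. a i * (D z i)\<^sup>2) / (nr (D z))\<^sup>2) = 2 * \<theta> * w - excess z"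
    using pos by (simp add: excess_def field_simps)
  have "2 * \<theta> * hamiltonian N a (D z) = N * (2 * \<theta> * ((\<Sum>i\<in>{1..N}. a i * (D z i)\<^sup>2) / (nr (D z))\<^sup>2))"
    by (simp only: hamiltonian_eq nr_def times_divide_eq_right mult_ac)
  then have "2 * \<theta> * hamiltonian N a (D z) = N * (2 * \<theta> * w - excess z)"
    unfolding q .
  then have H: "\<theta> * hamiltonian N a (D z) = N * \<theta> * w - N / 2 * excess z"
    by (simp add: field_simps)
  have "(nr z / nr (D z)) ^ N = exp (N * ln (nr z / nr (D z)))"
    using assms pos by (simp add: exp_of_nat_mult)
  also have "ln (nr z / nr (D z)) = ln (1 + excess z) / 2"
  proof -
    have "1 + excess z = (nr z / nr (D z))\<^sup>2" by (simp add: excess_def power_divide)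
    then show ?thesis using assms pos by (simp add: ln_realpow)
  qed
  finally show ?thesis
    unfolding H density_ratio_def by (simp add: exp_add[symmetric] algebra_simps)
qed

lemma density_ratio_le_1: "nr z > 0 \<Longrightarrow> density_ratio z \<le> 1"
  using excess_bound[of z] ln_add_one_self_le_self2[of "excess z"] by (auto simp: density_ratio_def)

lemma measurable_D [measurable]: "D \<in> measurable (PiM {1..N} (\<lambda>_. borel)) (PiM {1..N} (\<lambda>_. borel))"
  unfolding D_def by measurable

lemma measurable_nr [measurable]: "nr \<in> borel_measurable (PiM {1..N} (\<lambda>_. borel))"
  unfolding nr_def by measurable

lemma measurable_density_ratio [measurable]: "density_ratio \<in> borel_measurable (PiM {1..N} (\<lambda>_. borel))"
  unfolding density_ratio_def excess_def by measurable

text \<open>All three differences are sums of \<open>c i * ((z i)\<^sup>2 - 1)\<close>, with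
  \<open>c\<close> equal to \<open>s\<close>, 1 and \<open>1 - s\<close>, so their variances are
  twice the sum of the squares of \<open>c\<close>. For the first and the third the constant term
  disappears by \<open>sum_s\<close>: here the choice of \<open>w\<close> enters.\<close>

lemma norm_fluctuation:
  shows "integrable (std_gaussian N) (\<lambda>z. ((nr (D z))\<^sup>2 - N)\<^sup>2)"
    "(\<integral>z. ((nr (D z))\<^sup>2 - N)\<^sup>2 \<partial>std_gaussian N) \<le> 8 * N"
    "integrable (std_gaussian N) (\<lambda>z. ((nr z)\<^sup>2 - N)\<^sup>2)"
    "(\<integral>z. ((nr z)\<^sup>2 - N)\<^sup>2 \<partial>std_gaussian N) \<le> 2 * N"
    "integrable (std_gaussian N) (\<lambda>z. ((nr z)\<^sup>2 - (nr (D z))\<^sup>2)\<^sup>2)"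
    "(\<integral>z. ((nr z)\<^sup>2 - (nr (D z))\<^sup>2)\<^sup>2 \<partial>std_gaussian N) \<le> 2 * N"
proof -
  have e1: "(nr (D z))\<^sup>2 - N = (\<Sum>i\<in>{1..N}. s i * ((z i)\<^sup>2 - 1))" for z
    unfolding nr_D_sq by (simp add: algebra_simps sum_subtractf sum_s[simplified])
  have e2: "(nr z)\<^sup>2 - N = (\<Sum>i\<in>{1..N}. 1 * ((z i)\<^sup>2 - 1))" for z
    unfolding nr_sq by (simp add: sum_subtractf)
  have e3: "(nr z)\<^sup>2 - (nr (D z))\<^sup>2 = (\<Sum>i\<in>{1..N}. (1 - s i) * ((z i)\<^sup>2 - 1))" for z
  proof -
    have "(nr z)\<^sup>2 - (nr (D z))\<^sup>2 = ((nr z)\<^sup>2 - N) - ((nr (D z))\<^sup>2 - N)" by simp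
    then show ?thesis unfolding e1 e2[of z] by (simp only: sum_subtractf[symmetric] left_diff_distrib)
  qed
  have b1: "2 * (\<Sum>i\<in>{1..N}. (s i)\<^sup>2) \<le> 8 * N"
  proof -
    have "(\<Sum>i\<in>{1..N}. (s i)\<^sup>2) \<le> (\<Sum>i\<in>{1..N}. 4)"
      using s_bounds power_mono[of "s _" 2 2] by (intro sum_mono) (auto simp: less_imp_le)
    then show ?thesis by simp
  qed
  have b3: "2 * (\<Sum>i\<in>{1..N}. (1 - s i)\<^sup>2) \<le> 2 * N"
  proof -
    have "(\<Sum>i\<in>{1..N}. (1 - s i)\<^sup>2) \<le> (\<Sum>i\<in>{1..N}. 1)"
    proof (rule sum_mono)
      fix i assume "i \<in> {1..N}"
      then show "(1 - s i)\<^sup>2 \<le> 1" using s_bounds[of i] by (auto simp: abs_square_le_1)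
    qed
    then show ?thesis by simp
  qed
  show "integrable (std_gaussian N) (\<lambda>z. ((nr (D z))\<^sup>2 - N)\<^sup>2)"
    unfolding e1 by (rule weighted_chi_square_variance)
  show "(\<integral>z. ((nr (D z))\<^sup>2 - N)\<^sup>2 \<partial>std_gaussian N) \<le> 8 * N"
    unfolding e1 weighted_chi_square_variance by (rule b1)
  show "integrable (std_gaussian N) (\<lambda>z. ((nr z)\<^sup>2 - N)\<^sup>2)"
    unfolding e2 by (rule weighted_chi_square_variance)
  show "(\<integral>z. ((nr z)\<^sup>2 - N)\<^sup>2 \<partial>std_gaussian N) \<le> 2 * N"
    unfolding e2 weighted_chi_square_variance by simp
  show "integrable (std_gaussian N) (\<lambda>z. ((nr z)\<^sup>2 - (nr (D z))\<^sup>2)\<^sup>2)"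
    unfolding e3 by (rule weighted_chi_square_variance)
  show "(\<integral>z. ((nr z)\<^sup>2 - (nr (D z))\<^sup>2)\<^sup>2 \<partial>std_gaussian N) \<le> 2 * N"
    unfolding e3 weighted_chi_square_variance by (rule b3)
qed

text \<open>The exponent is at most \<open>N * (excess z)\<^sup>2\<close>, which has the random
  denominator \<open>(nr (D z))\<^sup>2\<close>. A case distinction avoids inverse moments: if the
  denominator is at least \<open>N / 2\<close>, it is replaced by \<open>N / 2\<close>; otherwise
  \<open>(nr (D z))\<^sup>2\<close> is at distance at least \<open>N / 2\<close> from
  \<open>N\<close>, and the crude bound 1 for \<open>(excess z)\<^sup>2\<close> is enough.\<close>

lemma density_ratio_ge:
  assumes "nr z > 0"
  shows "density_ratio z \<ge> exp (- (4 * (((nr (D z))\<^sup>2 - N)\<^sup>2 + ((nr z)\<^sup>2 - (nr (D z))\<^sup>2)\<^sup>2) / N))"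
proof -
  define X where "X = (nr (D z))\<^sup>2 - N"
  define Y where "Y = (nr z)\<^sup>2 - (nr (D z))\<^sup>2"
  have Np: "real N > 0" using N by simp
  have pos: "(nr (D z))\<^sup>2 > 0" using nr_D_pos[OF assms] by simp
  have t: "excess z = Y / (nr (D z))\<^sup>2" using pos by (simp add: excess_def Y_def field_simps)
  have "N * (excess z)\<^sup>2 \<le> 4 * (X\<^sup>2 + Y\<^sup>2) / N"
  proof (cases "(nr (D z))\<^sup>2 \<ge> N / 2")
    case True
    have "(N * \<bar>excess z\<bar>)\<^sup>2 \<le> (2 * \<bar>Y\<bar>)\<^sup>2"
    proof (rule power_mono)
      have "N * \<bar>excess z\<bar> = N * \<bar>Y\<bar> / (nr (D z))\<^sup>2" using pos by (simp add: t)
      also have "\<dots> \<le> 2 * \<bar>Y\<bar>"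
        using pos mult_right_mono[OF True abs_ge_zero[of Y]] by (simp add: field_simps)
      finally show "N * \<bar>excess z\<bar> \<le> 2 * \<bar>Y\<bar>" .
    qed simp
    then have "N\<^sup>2 * (excess z)\<^sup>2 \<le> 4 * Y\<^sup>2" by (simp add: power_mult_distrib)
    also have "\<dots> \<le> 4 * (X\<^sup>2 + Y\<^sup>2)" by simp
    finally show ?thesis 
      unfolding pos_le_divide_eq[OF Np] by (simp only: power2_eq_square mult_ac of_nat_mult)
  next
    case False
    then have "N / 2 \<le> - X" by (simp add: X_def)
    then have "(N / 2)\<^sup>2 \<le> (- X)\<^sup>2" by (rule power_mono) simp
    then have "N\<^sup>2 \<le> 4 * X\<^sup>2" by (simp add: power_divide)
    moreover have "(excess z)\<^sup>2 \<le> 1" using excess_bound[OF assms] by (simp add: abs_square_le_1)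
    ultimately have "N\<^sup>2 * (excess z)\<^sup>2 \<le> 4 * X\<^sup>2" using mult_left_mono[of "(excess z)\<^sup>2" 1 "(real N)\<^sup>2"] by simp
    also have "\<dots> \<le> 4 * (X\<^sup>2 + Y\<^sup>2)" by simp
    finally show ?thesis 
      unfolding pos_le_divide_eq[OF Np] by (simp only: power2_eq_square mult_ac of_nat_mult)
  qed
  moreover have "excess z - ln (1 + excess z) \<le> 2 * (excess z)\<^sup>2"
    using abs_ln_one_plus_x_minus_x_bound[OF excess_bound[OF assms]] by linarith
  then have "N / 2 * (excess z - ln (1 + excess z)) \<le> N * (excess z)\<^sup>2"
    using mult_left_mono[of "excess z - ln (1 + excess z)" "2 * (excess z)\<^sup>2" "N / 2"] by simp
  ultimately have "N / 2 * (excess z - ln (1 + excess z)) \<le> 4 * (X\<^sup>2 + Y\<^sup>2) / N"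
    by linarith
  then show ?thesis unfolding density_ratio_def X_def[symmetric] Y_def[symmetric]
    by (simp only: exp_le_cancel_iff mult_minus_left neg_le_iff_le)
qed

text \<open>Jensen's inequality for \<open>exp\<close>, as a tangent line estimate at \<open>-40\<close>.\<close>
lemma density_ratio_mass: "ennreal (exp (- 40)) \<le> (\<integral>\<^sup>+z. ennreal (density_ratio z) \<partial>std_gaussian N)"
proof -
  interpret G: prob_space "std_gaussian N" by (rule prob_space_std_gaussian)
  define U where "U z = 4 * (((nr (D z))\<^sup>2 - N)\<^sup>2 + ((nr z)\<^sup>2 - (nr (D z))\<^sup>2)\<^sup>2) / N" for z
  have Np: "real N > 0" using N by simp
  have int_U: "integrable (std_gaussian N) U"
    unfolding U_def using norm_fluctuation by auto
  have U_le: "(\<integral>z. U z \<partial>std_gaussian N) \<le> 40"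
  proof -
    have "(\<integral>z. U z \<partial>std_gaussian N) = 4 * ((\<integral>z. ((nr (D z))\<^sup>2 - N)\<^sup>2 \<partial>std_gaussian N)
       + (\<integral>z. ((nr z)\<^sup>2 - (nr (D z))\<^sup>2)\<^sup>2 \<partial>std_gaussian N)) / N"
      unfolding U_def using norm_fluctuation by simp
    \<comment> \<open>The bounds \<open>8 * N\<close> and \<open>2 * N\<close> of
      \<open>norm_fluctuation\<close> are the origin of the number 40.\<close>
    also have "\<dots> \<le> 4 * (8 * N + 2 * N) / N"
      using norm_fluctuation Np by (intro divide_right_mono mult_left_mono add_mono) auto
    finally show ?thesis using Np by simp
  qed
  have "exp (- 40) \<le> exp (-40) * (1 + 40 - (\<integral>z. U z \<partial>std_gaussian N))"
    using U_le by simp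
  also have "\<dots> = (\<integral>z. exp (-40) * (1 + 40 - U z) \<partial>std_gaussian N)"
    using int_U G.prob_space by simp
  finally have "ennreal (exp (- 40)) \<le> ennreal (\<integral>z. exp (-40) * (1 + 40 - U z) \<partial>std_gaussian N)"
    by (rule ennreal_leI)
  also have "\<dots> \<le> (\<integral>\<^sup>+z. ennreal (exp (-40) * (1 + 40 - U z)) \<partial>std_gaussian N)"
  proof -
    have i: "integrable (std_gaussian N) (\<lambda>z. exp (-40) * (1 + 40 - U z))" using int_U by auto
    \<comment> \<open>The tangent line takes negative values, which \<open>ennreal\<close> truncates
      at 0; passing to the positive part only increases the integral.\<close>
    have "(\<integral>z. exp (-40) * (1 + 40 - U z) \<partial>std_gaussian N) \<le> (\<integral>z. max 0 (exp (-40) * (1 + 40 - U z)) \<partial>std_gaussian N)"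
      using i by (intro integral_mono integrable_max) auto
    then have "ennreal (\<integral>z. exp (-40) * (1 + 40 - U z) \<partial>std_gaussian N) \<le> ennreal (\<integral>z. max 0 (exp (-40) * (1 + 40 - U z)) \<partial>std_gaussian N)"
      by (rule ennreal_leI)
    also have "\<dots> = (\<integral>\<^sup>+z. ennreal (max 0 (exp (-40) * (1 + 40 - U z))) \<partial>std_gaussian N)"
      using i by (intro nn_integral_eq_integral[symmetric] integrable_max) auto
    also have "\<dots> = (\<integral>\<^sup>+z. ennreal (exp (-40) * (1 + 40 - U z)) \<partial>std_gaussian N)"
      by (intro nn_integral_cong) (auto simp: max_def ennreal_neg)
    finally show ?thesis .
  qed
  also have "\<dots> \<le> (\<integral>\<^sup>+z. ennreal (density_ratio z) \<partial>std_gaussian N)"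
  proof (rule nn_integral_mono_AE, rule AE_mp[OF AE_std_gaussian_L2_set_pos[OF N]], intro AE_I2 impI ennreal_leI)
    fix z assume "L2_set z {1..N} > 0"
    then have "nr z > 0" by (simp only: nr_def)
    then have "exp (- U z) \<le> density_ratio z" unfolding U_def by (rule density_ratio_ge)
    moreover have "exp (-40) * (1 + 40 - U z) \<le> exp (-40) * exp (40 - U z)"
      using exp_ge_add_one_self[of "40 - U z"] by (intro mult_left_mono) auto
    moreover have "exp (-40) * exp (40 - U z) = exp (- U z)"
      by (simp add: exp_add[symmetric])
    ultimately show "exp (-40) * (1 + 40 - U z) \<le> density_ratio z" by simp
  qed
  finally show ?thesis .
qed

text \<open>The direction of \<open>D z\<close> with the resampled radius \<open>nr x\<close>, which has the Gibbs law of \<open>nr g\<close>.\<close>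
definition recombine where "recombine x z = dilate {1..N} (\<lambda>_. nr x / nr (D z)) (D z)"

text \<open>Numerator and partition function contain the same factor \<open>C\<close>, which may be
  exponentially large or small in \<open>N\<close> and cancels. What remains is weighted by
  \<open>density_ratio\<close>: it is at most 1, which bounds the numerator by the mean under the
  product measure, and it has mass at least \<open>exp (- 40)\<close>, which bounds the
  denominator.\<close>

lemma gibbs_mean_le:
  assumes [measurable]: "\<phi> \<in> borel_measurable (PiM {1..N} (\<lambda>_. borel))"
    and nonneg: "\<And>g. 0 \<le> \<phi> g" and "B \<ge> 0"
    and B: "(\<integral>\<^sup>+z. \<integral>\<^sup>+x. ennreal (\<phi> (recombine x z)) \<partial>std_gaussian N \<partial>std_gaussian N) \<le> ennreal B"
  shows "0 \<le> gibbs_mean N a \<theta> \<phi>" "gibbs_mean N a \<theta> \<phi> \<le> exp 40 * B"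
proof -
  interpret G: prob_space "std_gaussian N" by (rule prob_space_std_gaussian)
  define C where "C = (\<Prod>i\<in>{1..N}. sqrt (s i)) * exp (N * \<theta> * w)"
  define m where "m = (\<integral>\<^sup>+z. ennreal (density_ratio z) \<partial>std_gaussian N)"
  have Cpos: "C > 0" unfolding C_def using s_bounds by (intro mult_pos_pos prod_pos) auto
  have AE_nr: "AE z in std_gaussian N. nr z > 0"
    using AE_std_gaussian_L2_set_pos[OF N] by (simp only: nr_def)
  have polar: "(\<integral>\<^sup>+g. ennreal (\<psi> g * exp (\<theta> * hamiltonian N a g)) \<partial>std_gaussian N)
     = ennreal C * (\<integral>\<^sup>+z. ennreal (density_ratio z) * (\<integral>\<^sup>+x. ennreal (\<psi> (recombine x z)) \<partial>std_gaussian N) \<partial>std_gaussian N)"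
    if [measurable]: "\<psi> \<in> borel_measurable (PiM {1..N} (\<lambda>_. borel))" and "\<And>g. 0 \<le> \<psi> g" for \<psi>
  proof -
    have "(\<integral>\<^sup>+g. ennreal (\<psi> g * exp (\<theta> * hamiltonian N a g)) \<partial>std_gaussian N)
      = (\<integral>\<^sup>+g. ennreal (\<psi> g) * ennreal (exp (\<theta> * hamiltonian N a g)) \<partial>std_gaussian N)"
      using that(2) by (simp add: ennreal_mult)
    also have "\<dots> = ennreal (\<Prod>i\<in>{1..N}. sqrt (s i)) * (\<integral>\<^sup>+z. ennreal (exp (\<theta> * hamiltonian N a (D z))) * ennreal ((nr z / nr (D z)) ^ N) *
        (\<integral>\<^sup>+x. ennreal (\<psi> (recombine x z)) \<partial>std_gaussian N) \<partial>std_gaussian N)"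
      unfolding recombine_def D_def nr_def
    proof (rule gaussian_polar[OF N])
      show "(\<lambda>g. ennreal (\<psi> g)) \<in> borel_measurable (PiM {1..N} (\<lambda>_. borel))" by measurable
      show "(\<lambda>g. ennreal (exp (\<theta> * hamiltonian N a g))) \<in> borel_measurable (PiM {1..N} (\<lambda>_. borel))" by measurable
    qed (use s_bounds in \<open>simp_all only: hamiltonian_dilate real_sqrt_gt_0_iff\<close>)
    also have "\<dots> = ennreal (\<Prod>i\<in>{1..N}. sqrt (s i)) * (\<integral>\<^sup>+z. ennreal (exp (N * \<theta> * w)) * (ennreal (density_ratio z) *
        (\<integral>\<^sup>+x. ennreal (\<psi> (recombine x z)) \<partial>std_gaussian N)) \<partial>std_gaussian N)"
    proof (rule arg_cong2[where f="(*)", OF refl], rule nn_integral_cong_AE, rule AE_mp[OF AE_nr], intro AE_I2 impI)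
      fix z assume "nr z > 0"
      note w = gibbs_weight_D[OF this] and p = nr_D_pos[OF this] and n = this
      have "ennreal (exp (\<theta> * hamiltonian N a (D z))) * ennreal ((nr z / nr (D z)) ^ N)
         = ennreal (exp (N * \<theta> * w)) * ennreal (density_ratio z)"
        using n p by (simp add: ennreal_mult[symmetric] w density_ratio_def)
      then show "ennreal (exp (\<theta> * hamiltonian N a (D z))) * ennreal ((nr z / nr (D z)) ^ N) *
        (\<integral>\<^sup>+x. ennreal (\<psi> (recombine x z)) \<partial>std_gaussian N)
        = ennreal (exp (N * \<theta> * w)) * (ennreal (density_ratio z) *
        (\<integral>\<^sup>+x. ennreal (\<psi> (recombine x z)) \<partial>std_gaussian N))"
        by (simp only: mult.assoc)
    qed
    also have "\<dots> = ennreal C * (\<integral>\<^sup>+z. ennreal (density_ratio z) * (\<integral>\<^sup>+x. ennreal (\<psi> (recombine x z)) \<partial>std_gaussian N) \<partial>std_gaussian N)"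
    proof (subst nn_integral_cmult)
      show "(\<lambda>z. ennreal (density_ratio z) * (\<integral>\<^sup>+x. ennreal (\<psi> (recombine x z)) \<partial>std_gaussian N)) \<in> borel_measurable (std_gaussian N)"
        unfolding recombine_def by measurable
      have "0 \<le> (\<Prod>i\<in>{1..N}. sqrt (s i))" using s_bounds by (intro prod_nonneg) (auto simp: less_imp_le)
      then have "ennreal C = ennreal (\<Prod>i\<in>{1..N}. sqrt (s i)) * ennreal (exp (N * \<theta> * w))"
        unfolding C_def by (rule ennreal_mult) simp
      then show "ennreal (\<Prod>i\<in>{1..N}. sqrt (s i)) * (ennreal (exp (N * \<theta> * w)) *
          (\<integral>\<^sup>+z. ennreal (density_ratio z) * (\<integral>\<^sup>+x. ennreal (\<psi> (recombine x z)) \<partial>std_gaussian N) \<partial>std_gaussian N))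
        = ennreal C * (\<integral>\<^sup>+z. ennreal (density_ratio z) * (\<integral>\<^sup>+x. ennreal (\<psi> (recombine x z)) \<partial>std_gaussian N) \<partial>std_gaussian N)"
        by (simp only: mult.assoc)
    qed
    finally show ?thesis .
  qed
  define X where "X = (\<integral>\<^sup>+z. ennreal (density_ratio z) * (\<integral>\<^sup>+x. ennreal (\<phi> (recombine x z)) \<partial>std_gaussian N) \<partial>std_gaussian N)"
  have num: "(\<integral>g. \<phi> g * exp (\<theta> * hamiltonian N a g) \<partial>std_gaussian N) = C * enn2real X"
    using polar[OF assms(1) nonneg] nonneg Cpos
    by (subst integral_eq_nn_integral) (auto simp: X_def enn2real_mult)
  have Z: "partition_function N a \<theta> = C * enn2real m"
    unfolding partition_function_def using polar[of "\<lambda>_. 1"] Cpos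
    by (subst integral_eq_nn_integral) (auto simp: m_def enn2real_mult G.emeasure_space_1)
  have dr: "AE z in std_gaussian N. ennreal (density_ratio z) \<le> 1"
    by (rule AE_mp[OF AE_nr]) (auto intro!: AE_I2 simp: density_ratio_le_1)
  have "m \<le> (\<integral>\<^sup>+z. 1 \<partial>std_gaussian N)" unfolding m_def using dr by (rule nn_integral_mono_AE)
  then have m_le: "m \<le> 1" by (simp add: G.emeasure_space_1)
  \<comment> \<open>Finiteness matters because \<open>enn2real\<close> sends infinity to 0, which
    would destroy the lower bound for the denominator.\<close>
  then have m_top: "m < \<top>" using ennreal_one_less_top order.strict_trans1 by blast
  have m_ge: "exp (-40) \<le> enn2real m"
    using density_ratio_mass m_top unfolding m_def[symmetric]
    by (metis enn2real_ennreal enn2real_mono exp_ge_zero)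
  have "X \<le> (\<integral>\<^sup>+z. \<integral>\<^sup>+x. ennreal (\<phi> (recombine x z)) \<partial>std_gaussian N \<partial>std_gaussian N)"
    unfolding X_def
    by (rule nn_integral_mono_AE, rule AE_mp[OF dr], intro AE_I2 impI) (metis mult_1 mult_right_mono zero_le)
  then have "X \<le> ennreal B" using B by (rule order_trans)
  then have X_le: "enn2real X \<le> B" using assms(3) enn2real_leI by blast
  have gm: "gibbs_mean N a \<theta> \<phi> = enn2real X / enn2real m"
    unfolding gibbs_mean_def num Z using Cpos by simp
  show "0 \<le> gibbs_mean N a \<theta> \<phi>" unfolding gm by simp
  have "enn2real X / enn2real m \<le> B / exp (-40)"
    using m_ge X_le assms(3) by (intro frac_le) auto
  then show "gibbs_mean N a \<theta> \<phi> \<le> exp 40 * B"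
    unfolding gm by (simp add: exp_minus field_simps)
qed

end

section \<open>Lipschitz observables under the product measure\<close>

text \<open>The variance is at most the second moment about \<open>f 0\<close>, and the Lipschitz
  condition bounds that by the second moment of \<open>c * x\<close>.\<close>

lemma lipschitz_std_normal:
  fixes f :: "real \<Rightarrow> real"
  assumes lip: "\<And>x y. \<bar>f x - f y\<bar> \<le> \<bar>x - y\<bar>" and [measurable]: "f \<in> borel_measurable borel"
  shows "integrable std_normal (\<lambda>x. f (c * x))"
    and "integrable std_normal (\<lambda>x. (f (c * x) - e)\<^sup>2)"
    and "(\<integral>x. (f (c * x) - (\<integral>x. f (c * x) \<partial>std_normal))\<^sup>2 \<partial>std_normal) \<le> c\<^sup>2"
proof -
  interpret S: prob_space std_normal by (rule prob_space_std_normal)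
  define v where "v x = f (c * x) - f 0" for x
  have [measurable]: "v \<in> borel_measurable borel" unfolding v_def by measurable
  have v_le: "\<bar>v x\<bar> \<le> \<bar>c * x\<bar>" for x using lip[of "c * x" 0] by (simp add: v_def)
  have v: "integrable std_normal v"
  proof (rule Bochner_Integration.integrable_bound)
    show "integrable std_normal (\<lambda>x. c * x)" using std_normal_moments(1)[of 1] by auto
  qed (use v_le in auto)
  have v2: "integrable std_normal (\<lambda>x. (v x)\<^sup>2)"
  proof (rule Bochner_Integration.integrable_bound)
    show "integrable std_normal (\<lambda>x. c\<^sup>2 * x\<^sup>2)" using std_normal_moments(1)[of 2] by auto
    show "AE x in std_normal. norm ((v x)\<^sup>2) \<le> norm (c\<^sup>2 * x\<^sup>2)"
      using v_le by (auto simp: power_mult_distrib[symmetric] abs_le_square_iff[symmetric])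
  qed auto
  have f_v: "f (c * x) = v x + f 0" for x by (simp add: v_def)
  show 1: "integrable std_normal (\<lambda>x. f (c * x))" unfolding f_v using v by auto
  have ex: "(f (c * x) - e)\<^sup>2 = (v x)\<^sup>2 + 2 * (f 0 - e) * v x + (f 0 - e)\<^sup>2" for x e
    unfolding f_v by (simp add: power2_eq_square algebra_simps)
  show "integrable std_normal (\<lambda>x. (f (c * x) - e)\<^sup>2)" unfolding ex using v v2 by auto
  define E where "E = (\<integral>x. v x \<partial>std_normal)"
  have Ef: "(\<integral>x. f (c * x) \<partial>std_normal) = E + f 0"
    unfolding f_v E_def using v S.prob_space by simp
  have "(\<integral>x. (f (c * x) - (E + f 0))\<^sup>2 \<partial>std_normal) = (\<integral>x. (v x)\<^sup>2 \<partial>std_normal) - E\<^sup>2"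
    unfolding ex using v v2 S.prob_space by (simp add: E_def[symmetric] power2_eq_square)
  also have "\<dots> \<le> (\<integral>x. (v x)\<^sup>2 \<partial>std_normal)" by simp
  also have "\<dots> \<le> (\<integral>x. c\<^sup>2 * x\<^sup>2 \<partial>std_normal)"
  proof (rule integral_mono[OF v2])
    show "integrable std_normal (\<lambda>x. c\<^sup>2 * x\<^sup>2)" using std_normal_moments(1)[of 2] by auto
    show "(v x)\<^sup>2 \<le> c\<^sup>2 * x\<^sup>2" for x
      using v_le[of x] by (simp add: power_mult_distrib[symmetric] abs_le_square_iff[symmetric])
  qed
  also have "\<dots> = c\<^sup>2" using std_normal_moments(3) by simp
  finally show "(\<integral>x. (f (c * x) - (\<integral>x. f (c * x) \<partial>std_normal))\<^sup>2 \<partial>std_normal) \<le> c\<^sup>2"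
    unfolding Ef .
qed

text \<open>Divide the difference of squares \<open>r\<^sup>2 - n\<close> by
  \<open>r + sqrt n\<close>, which is at least \<open>sqrt n\<close>. This reduces fluctuations of a
  norm to those of its square, whose variance is explicit.\<close>

lemma dist_sqrt_sq_le:
  fixes r n :: real
  assumes "r \<ge> 0" "n > 0"
  shows "(r - sqrt n)\<^sup>2 \<le> (r\<^sup>2 - n)\<^sup>2 / n"
proof -
  have "n \<le> (r + sqrt n)\<^sup>2" using assms by (simp add: power2_sum)
  then have "(r - sqrt n)\<^sup>2 * n \<le> (r - sqrt n)\<^sup>2 * (r + sqrt n)\<^sup>2"
    by (intro mult_left_mono) auto
  also have "\<dots> = ((r - sqrt n) * (r + sqrt n))\<^sup>2" by (simp add: power_mult_distrib)
  also have "(r - sqrt n) * (r + sqrt n) = r\<^sup>2 - n"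
    using assms by (simp add: algebra_simps power2_eq_square)
  finally show ?thesis using assms by (simp add: field_simps)
qed

lemma sum3_sq_le: "(x + y + z)\<^sup>2 \<le> 3 * x\<^sup>2 + 3 * y\<^sup>2 + 3 * (z::real)\<^sup>2"
  using zero_le_power2[of "x - y"] zero_le_power2[of "y - z"] zero_le_power2[of "x - z"]
  by (simp add: power2_eq_square algebra_simps)

lemma diff_sq_le: "(x - y)\<^sup>2 \<le> 2 * (x - e)\<^sup>2 + 2 * (y - (e::real))\<^sup>2"
  using zero_le_power2[of "x + y - 2 * e"]
  by (simp add: power2_eq_square algebra_simps)

context tilted_gaussian
begin

text \<open>Three errors are separated: the change of radius from \<open>D z\<close> to
  \<open>recombine x z\<close>, the fluctuation of the observable at \<open>D z\<close> around its
  mean \<open>b\<close>, and the bias \<open>b - m\<close>. For the first, both points lie on one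
  ray, so apart from a null set their distance is the difference of the radii \<open>nr x\<close>
  and \<open>nr (D z)\<close>, both close to \<open>sqrt N\<close>; and an average of Lipschitz
  functions has Lipschitz constant \<open>1 / sqrt N\<close> in the Euclidean norm.\<close>

lemma gibbs_lipschitz_bound:
  fixes f :: "real \<Rightarrow> real" and m :: real
  assumes lip: "\<And>x y. \<bar>f x - f y\<bar> \<le> \<bar>x - y\<bar>" and [measurable]: "f \<in> borel_measurable borel"
  defines "b \<equiv> (\<Sum>i\<in>{1..N}. \<integral>x. f (sqrt (s i) * x) \<partial>std_normal) / N"
    and "\<phi> \<equiv> \<lambda>g. ((\<Sum>i\<in>{1..N}. f (g i)) / N - m)\<^sup>2"
  shows "0 \<le> gibbs_mean N a \<theta> \<phi>" "gibbs_mean N a \<theta> \<phi> \<le> exp 40 * (66 / N + 3 * (b - m)\<^sup>2)"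
proof -
  interpret G: prob_space "std_gaussian N" by (rule prob_space_std_gaussian)
  interpret S: prob_space std_normal by (rule prob_space_std_normal)
  define F where "F g = (\<Sum>i\<in>{1..N}. f (g i)) / N" for g :: "nat \<Rightarrow> real"
  define P where "P x = ((nr x)\<^sup>2 - N)\<^sup>2" for x
  define V where "V z = (F (D z) - b)\<^sup>2" for z
  define R where "R z = 6 / N\<^sup>2 * P (D z) + 3 * V z + 3 * (b - m)\<^sup>2" for z
  have Np: "real N > 0" using N by simp
  have F_meas[measurable]: "F \<in> borel_measurable (PiM {1..N} (\<lambda>_. borel))"
    unfolding F_def by measurable
  have \<phi>_meas: "\<phi> \<in> borel_measurable (PiM {1..N} (\<lambda>_. borel))"
    unfolding \<phi>_def by measurable
  have V_eq: "V z = 1 / N\<^sup>2 * (\<Sum>i\<in>{1..N}. f (sqrt (s i) * z i) - (\<integral>x. f (sqrt (s i) * x) \<partial>std_normal))\<^sup>2" for z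
  proof -
    have "F (D z) - b = (\<Sum>i\<in>{1..N}. f (sqrt (s i) * z i) - (\<integral>x. f (sqrt (s i) * x) \<partial>std_normal)) / N"
      unfolding F_def b_def sum_subtractf diff_divide_distrib[symmetric]
      by (intro arg_cong2[where f="(/)"] arg_cong2[where f="(-)"] sum.cong refl) (simp only: D_apply)
    then show ?thesis by (simp add: V_def power_divide)
  qed
  have u: "integrable std_normal (\<lambda>x. f (sqrt (s i) * x) - (\<integral>x. f (sqrt (s i) * x) \<partial>std_normal))"
    "(\<integral>x. f (sqrt (s i) * x) - (\<integral>x. f (sqrt (s i) * x) \<partial>std_normal) \<partial>std_normal) = 0"
    "integrable std_normal (\<lambda>x. (f (sqrt (s i) * x) - (\<integral>x. f (sqrt (s i) * x) \<partial>std_normal))\<^sup>2)" for i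
    using lipschitz_std_normal[OF lip assms(2)] S.prob_space by auto
  note V_var = std_gaussian_sum_sq[of N "\<lambda>i x. f (sqrt (s i) * x) - (\<integral>x. f (sqrt (s i) * x) \<partial>std_normal)", OF u]
  have int_V: "integrable (std_gaussian N) V"
    unfolding V_eq using V_var(1) by (rule integrable_mult_right)
  have EV: "(\<integral>z. V z \<partial>std_gaussian N) \<le> 2 / N"
  proof -
    have "(\<Sum>i\<in>{1..N}. \<integral>x. (f (sqrt (s i) * x) - (\<integral>x. f (sqrt (s i) * x) \<partial>std_normal))\<^sup>2 \<partial>std_normal)
      \<le> (\<Sum>i\<in>{1..N}. 2)"
    proof (rule sum_mono)
      fix i assume i: "i \<in> {1..N}"
      have "(\<integral>x. (f (sqrt (s i) * x) - (\<integral>x. f (sqrt (s i) * x) \<partial>std_normal))\<^sup>2 \<partial>std_normal) \<le> (sqrt (s i))\<^sup>2"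
        by (rule lipschitz_std_normal[OF lip assms(2)])
      also have "\<dots> \<le> 2" using s_bounds(1,2)[OF i] by simp
      finally show "(\<integral>x. (f (sqrt (s i) * x) - (\<integral>x. f (sqrt (s i) * x) \<partial>std_normal))\<^sup>2 \<partial>std_normal) \<le> 2" .
    qed
    then have "1 / N\<^sup>2 * (\<Sum>i\<in>{1..N}. \<integral>x. (f (sqrt (s i) * x) - (\<integral>x. f (sqrt (s i) * x) \<partial>std_normal))\<^sup>2 \<partial>std_normal)
      \<le> 1 / N\<^sup>2 * (2 * N)" by (intro mult_left_mono) auto
    also have "\<dots> = 2 / N" using Np by (simp add: power2_eq_square)
    finally show ?thesis unfolding V_eq by (simp only: Bochner_Integration.integral_mult_right_zero V_var(2))
  qed
  note fl = norm_fluctuation[folded P_def]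
  have R_nonneg: "0 \<le> R z" "0 \<le> P z" for z by (auto simp: R_def P_def V_def)
  have int_R: "integrable (std_gaussian N) R"
    unfolding R_def using fl(1) int_V by auto
  have ER: "6 / N\<^sup>2 * (\<integral>x. P x \<partial>std_gaussian N) + (\<integral>z. R z \<partial>std_gaussian N) \<le> 66 / N + 3 * (b - m)\<^sup>2"
  proof -
    have "(\<integral>z. R z \<partial>std_gaussian N) = 6 / N\<^sup>2 * (\<integral>z. P (D z) \<partial>std_gaussian N) + 3 * (\<integral>z. V z \<partial>std_gaussian N) + 3 * (b - m)\<^sup>2"
      unfolding R_def using fl(1) int_V G.prob_space by simp
    moreover have "6 / N\<^sup>2 * (\<integral>z. P (D z) \<partial>std_gaussian N) \<le> 6 / N\<^sup>2 * (8 * N)"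
      using fl(2) by (intro mult_left_mono) auto
    moreover have "6 / N\<^sup>2 * (\<integral>z. P z \<partial>std_gaussian N) \<le> 6 / N\<^sup>2 * (2 * N)"
      using fl(4) by (intro mult_left_mono) auto
    \<comment> \<open>The constant 66 is the sum of 48 from the radius of \<open>D z\<close>, 12
      from the radius of \<open>x\<close>, and 6 from the variance of the observable.\<close>
    moreover have "6 / N\<^sup>2 * (8 * N) = 48 / N" "6 / N\<^sup>2 * (2 * N) = 12 / N"
      using Np by (auto simp: power2_eq_square)
    moreover have "66 / real N = 48 / N + 12 / N + 3 * (2 / N)" by (simp add: field_simps)
    ultimately show ?thesis using EV by linarith
  qed
  have ptw: "\<phi> (recombine x z) \<le> 6 / N\<^sup>2 * P x + R z" for x z
  proof -
    let ?y = "recombine x z"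
    have "\<phi> ?y = ((F ?y - F (D z)) + (F (D z) - b) + (b - m))\<^sup>2"
      by (simp add: \<phi>_def F_def)
    also have "\<dots> \<le> 3 * (F ?y - F (D z))\<^sup>2 + 3 * V z + 3 * (b - m)\<^sup>2"
      unfolding V_def by (rule sum3_sq_le)
    also have "(F ?y - F (D z))\<^sup>2 \<le> 2 / N\<^sup>2 * (P x + P (D z))"
    proof -
      define r where "r = nr x / nr (D z) - 1"
      have nn: "0 \<le> nr x" "0 \<le> nr (D z)" by (simp_all add: nr_def L2_set_nonneg)
      have "(\<Sum>i\<in>{1..N}. (f (?y i) - f (D z i))\<^sup>2) \<le> (\<Sum>i\<in>{1..N}. r\<^sup>2 * (D z i)\<^sup>2)"
      proof (rule sum_mono)
        fix i assume "i \<in> {1..N}"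
        then have "?y i - D z i = r * D z i"
          by (simp add: recombine_def dilate_def r_def algebra_simps)
        then have "\<bar>f (?y i) - f (D z i)\<bar> \<le> \<bar>r * D z i\<bar>" using lip[of "?y i" "D z i"] by simp
        then show "(f (?y i) - f (D z i))\<^sup>2 \<le> r\<^sup>2 * (D z i)\<^sup>2"
          by (simp add: power_mult_distrib[symmetric] abs_le_square_iff[symmetric])
      qed
      also have "(\<Sum>i\<in>{1..N}. r\<^sup>2 * (D z i)\<^sup>2) = (r * nr (D z))\<^sup>2"
        by (simp only: nr_sq sum_distrib_left power_mult_distrib)
      also have "(r * nr (D z))\<^sup>2 \<le> (nr x - nr (D z))\<^sup>2"
      \<comment> \<open>If \<open>D z\<close> vanishes, \<open>r\<close> is -1 by the convention for
        division by zero, but the left-hand side is 0 all the same.\<close>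
      proof (cases "nr (D z) = 0")
        case False
        then have "r * nr (D z) = nr x - nr (D z)" by (simp add: r_def field_simps)
        then show ?thesis by simp
      qed simp
      also have "\<dots> \<le> 2 * (nr x - sqrt N)\<^sup>2 + 2 * (nr (D z) - sqrt N)\<^sup>2"
        by (rule diff_sq_le)
      also have "\<dots> \<le> 2 * (P x / N) + 2 * (P (D z) / N)"
        unfolding P_def using nn Np by (intro add_mono mult_left_mono dist_sqrt_sq_le) auto
      finally have "(\<Sum>i\<in>{1..N}. (f (?y i) - f (D z i))\<^sup>2) * N \<le> (2 * (P x / N) + 2 * (P (D z) / N)) * N"
        using Np by (intro mult_right_mono) auto
      also have "\<dots> = 2 * (P x + P (D z))"
        using Np by (simp add: field_simps)
      finally have "(\<Sum>i\<in>{1..N}. f (?y i) - f (D z i))\<^sup>2 \<le> 2 * (P x + P (D z))"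
        \<comment> \<open>The Cauchy-Schwarz inequality; its factor \<open>N\<close> is the gain of
          \<open>1 / N\<close> after division by \<open>N\<^sup>2\<close>.\<close>
        using sum_squared_le_sum_of_squares[of "\<lambda>i. f (?y i) - f (D z i)" "{1..N}"] by simp
      then have "(\<Sum>i\<in>{1..N}. f (?y i) - f (D z i))\<^sup>2 / N\<^sup>2 \<le> 2 * (P x + P (D z)) / N\<^sup>2"
        by (rule divide_right_mono) simp
      then show ?thesis
        by (simp add: F_def sum_subtractf diff_divide_distrib[symmetric] power_divide)
    qed
    finally show ?thesis by (simp add: R_def algebra_simps add_divide_distrib)
  qed
  have "(\<integral>\<^sup>+z. \<integral>\<^sup>+x. ennreal (\<phi> (recombine x z)) \<partial>std_gaussian N \<partial>std_gaussian N)
    \<le> (\<integral>\<^sup>+z. \<integral>\<^sup>+x. ennreal (6 / N\<^sup>2 * P x + R z) \<partial>std_gaussian N \<partial>std_gaussian N)"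
    by (intro nn_integral_mono ennreal_leI ptw)
  also have "\<dots> = (\<integral>\<^sup>+z. ennreal (6 / N\<^sup>2 * (\<integral>x. P x \<partial>std_gaussian N) + R z) \<partial>std_gaussian N)"
  proof (rule nn_integral_cong)
    fix z
    have "(\<integral>\<^sup>+x. ennreal (6 / N\<^sup>2 * P x + R z) \<partial>std_gaussian N) = ennreal (\<integral>x. 6 / N\<^sup>2 * P x + R z \<partial>std_gaussian N)"
      using fl(3) R_nonneg by (intro nn_integral_eq_integral) auto
    then show "(\<integral>\<^sup>+x. ennreal (6 / N\<^sup>2 * P x + R z) \<partial>std_gaussian N) = ennreal (6 / N\<^sup>2 * (\<integral>x. P x \<partial>std_gaussian N) + R z)"
      using fl(3) G.prob_space by simp
  qed
  also have "\<dots> = ennreal (\<integral>z. 6 / N\<^sup>2 * (\<integral>x. P x \<partial>std_gaussian N) + R z \<partial>std_gaussian N)"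
    using int_R R_nonneg by (intro nn_integral_eq_integral) (auto intro!: AE_I2 add_nonneg_nonneg integral_nonneg)
  also have "\<dots> = ennreal (6 / N\<^sup>2 * (\<integral>x. P x \<partial>std_gaussian N) + (\<integral>z. R z \<partial>std_gaussian N))"
    using int_R G.prob_space by simp
  also have "\<dots> \<le> ennreal (66 / N + 3 * (b - m)\<^sup>2)"
    by (rule ennreal_leI[OF ER])
  finally have B: "(\<integral>\<^sup>+z. \<integral>\<^sup>+x. ennreal (\<phi> (recombine x z)) \<partial>std_gaussian N \<partial>std_gaussian N) \<le> ennreal (66 / N + 3 * (b - m)\<^sup>2)" .
  have \<phi>_nonneg: "0 \<le> \<phi> g" for g by (simp add: \<phi>_def)
  show "0 \<le> gibbs_mean N a \<theta> \<phi>"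
    by (rule gibbs_mean_le(1)[OF \<phi>_meas \<phi>_nonneg _ B]) simp
  show "gibbs_mean N a \<theta> \<phi> \<le> exp 40 * (66 / N + 3 * (b - m)\<^sup>2)"
    by (rule gibbs_mean_le(2)[OF \<phi>_meas \<phi>_nonneg _ B]) simp
qed

end

section \<open>Convergence of the limiting objects\<close>

text \<open>The easy half of Kantorovich duality. The strict inequality yields a coupling of cost
  below \<open>\<delta>\<close>, so no optimal coupling is needed.\<close>

lemma wasserstein1_lipschitz:
  assumes W: "wasserstein1 \<mu> \<nu> < ennreal \<delta>"
    and lip: "\<And>x y. \<bar>g x - g y\<bar> \<le> L * \<bar>x - y\<bar>" and "L \<ge> 0"
    and [measurable]: "g \<in> borel_measurable borel"
    and int: "integrable \<mu> g" "integrable \<nu> g"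
  shows "\<bar>(\<integral>x. g x \<partial>\<mu>) - (\<integral>x. g x \<partial>\<nu>)\<bar> \<le> L * \<delta>"
proof -
  obtain \<pi> where \<pi>: "\<pi> \<in> couplings \<mu> \<nu>" and cost: "(\<integral>\<^sup>+ p. ennreal \<bar>fst p - snd p\<bar> \<partial>\<pi>) < ennreal \<delta>"
    using W unfolding wasserstein1_def INF_less_iff by blast
  have sets_\<pi>[measurable_cong]: "sets \<pi> = sets (borel \<Otimes>\<^sub>M borel)"
    and \<mu>: "distr \<pi> borel fst = \<mu>" and \<nu>: "distr \<pi> borel snd = \<nu>"
    using \<pi> by (auto simp: couplings_def)
  have i1: "integrable \<pi> (\<lambda>p. g (fst p))" using int(1) unfolding \<mu>[symmetric] by (subst (asm) integrable_distr_eq) auto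
  have i2: "integrable \<pi> (\<lambda>p. g (snd p))" using int(2) unfolding \<nu>[symmetric] by (subst (asm) integrable_distr_eq) auto
  have "(\<integral>x. g x \<partial>\<mu>) = (\<integral>p. g (fst p) \<partial>\<pi>)" unfolding \<mu>[symmetric] by (rule integral_distr) auto
  moreover have "(\<integral>x. g x \<partial>\<nu>) = (\<integral>p. g (snd p) \<partial>\<pi>)" unfolding \<nu>[symmetric] by (rule integral_distr) auto
  ultimately have "(\<integral>x. g x \<partial>\<mu>) - (\<integral>x. g x \<partial>\<nu>) = (\<integral>p. g (fst p) - g (snd p) \<partial>\<pi>)"
    using i1 i2 by simp
  then have "\<bar>(\<integral>x. g x \<partial>\<mu>) - (\<integral>x. g x \<partial>\<nu>)\<bar> \<le> (\<integral>p. \<bar>g (fst p) - g (snd p)\<bar> \<partial>\<pi>)"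
    by (simp only: integral_abs_bound)
  then have "ennreal \<bar>(\<integral>x. g x \<partial>\<mu>) - (\<integral>x. g x \<partial>\<nu>)\<bar> \<le> ennreal (\<integral>p. \<bar>g (fst p) - g (snd p)\<bar> \<partial>\<pi>)"
    by (rule ennreal_leI)
  also have "\<dots> = (\<integral>\<^sup>+p. ennreal \<bar>g (fst p) - g (snd p)\<bar> \<partial>\<pi>)"
    using i1 i2 by (intro nn_integral_eq_integral[symmetric]) auto
  also have "\<dots> \<le> (\<integral>\<^sup>+p. ennreal L * ennreal \<bar>fst p - snd p\<bar> \<partial>\<pi>)"
    using lip assms(3) by (intro nn_integral_mono) (simp add: ennreal_mult[symmetric] ennreal_leI)
  also have "\<dots> = ennreal L * (\<integral>\<^sup>+p. ennreal \<bar>fst p - snd p\<bar> \<partial>\<pi>)"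
    by (rule nn_integral_cmult) auto
  also have "\<dots> \<le> ennreal L * ennreal \<delta>" using cost by (intro mult_left_mono) auto
  finally have *: "ennreal \<bar>(\<integral>x. g x \<partial>\<mu>) - (\<integral>x. g x \<partial>\<nu>)\<bar> \<le> ennreal L * ennreal \<delta>" .
  have "\<delta> > 0" using cost by (metis ennreal_neg not_less not_less_zero)
  then show ?thesis using * assms(3) by (simp add: ennreal_mult[symmetric] ennreal_le_iff)
qed

lemma integral_empirical_measure:
  assumes "N \<ge> 1" and [measurable]: "g \<in> borel_measurable borel"
  shows "(\<integral>x. g x \<partial>empirical_measure N a) = (\<Sum>i\<in>{1..N}. g (a i)) / N"
  unfolding empirical_measure_def using assms
  by (subst integral_distr) (auto simp: integral_uniform_count_measure)

lemma normal_density_scale: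
  assumes "\<sigma> > 0"
  shows "\<sigma> * normal_density 0 \<sigma> (\<sigma> * x) = std_normal_density x"
proof -
  have "sqrt (2 * pi * \<sigma>\<^sup>2) = sqrt (2 * pi) * \<sigma>"
    using assms by (subst real_sqrt_mult) simp
  moreover have "- (\<sigma> * x - 0)\<^sup>2 / (2 * \<sigma>\<^sup>2) = - x\<^sup>2 / 2"
    using assms by (simp add: power_mult_distrib)
  ultimately show ?thesis
    unfolding normal_density_def using assms by simp
qed

text \<open>Represents every marginal as a multiple of one standard normal variable, so that
  marginals with different variances can be compared pointwise.\<close>

lemma integral_limit_marginal:
  fixes f :: "real \<Rightarrow> real"
  assumes "limit_variance c \<rho> \<theta> y > 0" and [measurable]: "f \<in> borel_measurable borel"
  shows "(\<integral>x. f x \<partial>limit_marginal c \<rho> \<theta> y) = (\<integral>x. f (sqrt (limit_variance c \<rho> \<theta> y) * x) \<partial>std_normal)"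
proof -
  let ?\<sigma> = "sqrt (limit_variance c \<rho> \<theta> y)"
  have \<sigma>: "?\<sigma> > 0" using assms by simp
  note nd = normal_density_scale[OF \<sigma>]
  have "(\<integral>x. f x \<partial>limit_marginal c \<rho> \<theta> y) = (\<integral>x. normal_density 0 ?\<sigma> x * f x \<partial>lborel)"
    unfolding limit_marginal_def by (subst integral_density) (auto simp: normal_density_nonneg)
  also have "\<dots> = ?\<sigma> * (\<integral>x. normal_density 0 ?\<sigma> (?\<sigma> * x) * f (?\<sigma> * x) \<partial>lborel)"
    using lborel_integral_real_affine[of ?\<sigma> "\<lambda>x. normal_density 0 ?\<sigma> x * f x" 0] \<sigma> by simp
  also have "\<dots> = (\<integral>x. ?\<sigma> * (normal_density 0 ?\<sigma> (?\<sigma> * x) * f (?\<sigma> * x)) \<partial>lborel)"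
    by (simp only: Bochner_Integration.integral_mult_right_zero)
  also have "\<dots> = (\<integral>x. std_normal_density x * f (?\<sigma> * x) \<partial>lborel)"
    by (simp only: nd mult.assoc[symmetric])
  also have "\<dots> = (\<integral>x. f (?\<sigma> * x) \<partial>std_normal)"
    by (subst integral_density) (auto simp: normal_density_nonneg)
  finally show ?thesis .
qed

text \<open>The integrand decreases in \<open>z\<close> on each side of the interval, is negative
  for \<open>z < 0\<close> and positive for \<open>z > c\<close>. Hence two points on the same side
  are separated by monotonicity, two points on different sides by the sign. Injectivity is what lets
  \<open>inv_into\<close> return the intended preimage.\<close>

lemma stieltjes_inj:
  assumes "real_distribution \<rho>" and supp: "AE y in \<rho>. y \<in> {0..c}" and "c > 0"
  shows "inj_on (stieltjes \<rho>) (UNIV - {0..c})"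
proof -
  interpret real_distribution \<rho> by fact
  have int: "integrable \<rho> (\<lambda>y. 1 / (z - y))" if "z \<notin> {0..c}" for z
  proof (rule integrable_const_bound)
    define \<delta> where "\<delta> = (if z < 0 then - z else z - c)"
    have \<delta>: "\<delta> > 0" using that \<open>c > 0\<close> by (auto simp: \<delta>_def)
    show "AE y in \<rho>. norm (1 / (z - y)) \<le> 1 / \<delta>"
      using supp
    proof eventually_elim
      case (elim y)
      have "\<delta> \<le> \<bar>z - y\<bar>" using elim by (auto simp: \<delta>_def)
      then have "1 / \<bar>z - y\<bar> \<le> 1 / \<delta>" using \<delta> by (intro frac_le) auto
      then show ?case by simp
    qed
  qed auto
  have less: "stieltjes \<rho> z < stieltjes \<rho> z'"
    if "z \<notin> {0..c}" "z' \<notin> {0..c}" "\<And>y. y \<in> {0..c} \<Longrightarrow> 1 / (z - y) < 1 / (z' - y)" for z z'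
    unfolding stieltjes_def
  proof (rule integral_less_AE_space)
    show "AE y in \<rho>. 1 / (z - y) < 1 / (z' - y)" using supp by eventually_elim (use that in auto)
  qed (use int that emeasure_space_1 in auto)
  have "stieltjes \<rho> z \<noteq> stieltjes \<rho> z'" if z: "z \<notin> {0..c}" "z' \<notin> {0..c}" "z < z'" for z z'
  proof -
    consider "z' < 0" | "z < 0" "c < z'" | "c < z" using z by (auto simp: not_le)
    then show ?thesis
    proof cases
      case 1
      then have "1 / (z' - y) < 1 / (z - y)" if "y \<in> {0..c}" for y
        using z that by (auto simp: divide_simps)
      from less[OF z(2,1) this] show ?thesis by simp
    next
      case 2
      then have "1 / (z - y) < 1 / (z' - y)" if "y \<in> {0..c}" for y
      proof -
        have "1 / (z - y) < 0" "0 < 1 / (z' - y)" using 2 that by auto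
        then show ?thesis by linarith
      qed
      from less[OF z(1,2) this] show ?thesis by simp
    next
      case 3
      then have "1 / (z' - y) < 1 / (z - y)" if "y \<in> {0..c}" for y
        using z that by (auto simp: divide_simps)
      from less[OF z(2,1) this] show ?thesis by simp
    qed
  qed
  then show ?thesis
    by (intro inj_onI) (metis DiffD2 linorder_neqE_linordered_idom)
qed

section \<open>Existence, identification and stability of the normalising shift\<close>

locale small_field =
  fixes \<theta> c :: real
  assumes c: "c > 0" and \<theta>: "\<theta> \<noteq> 0" and small: "2 * \<bar>\<theta>\<bar> * c \<le> 1 / 2"
begin

text \<open>Clamping makes the relevant functions of \<open>y\<close> Lipschitz on the whole line, so that the Wasserstein
  estimates need no assumption on the supports of the measures.\<close>

definition clamp where "clamp y = max 0 (min c y)"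
text \<open>The reciprocal of the variance attached to the eigenvalue \<open>y\<close> when the
  shift is \<open>v\<close>. The limit and the finite systems differ in the shift and in the measure
  integrated over \<open>y\<close>.\<close>

definition k where "k v y = 1 + 2 * \<theta> * (v - clamp y)"

lemma clamp_mem: "clamp y \<in> {0..c}" using c by (auto simp: clamp_def)
lemma clamp_id: "y \<in> {0..c} \<Longrightarrow> clamp y = y" by (auto simp: clamp_def)
lemma clamp_lip: "\<bar>clamp x - clamp y\<bar> \<le> \<bar>x - y\<bar>" by (auto simp: clamp_def max_def min_def)

lemma measurable_clamp [measurable]: "clamp \<in> borel_measurable borel"
  unfolding clamp_def by measurable

lemma field_le: "x \<in> {0..c} \<Longrightarrow> y \<in> {0..c} \<Longrightarrow> \<bar>2 * \<theta> * (x - y)\<bar> \<le> 1 / 2"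
proof -
  assume "x \<in> {0..c}" "y \<in> {0..c}"
  then have "\<bar>x - y\<bar> \<le> c" by auto
  then have "2 * \<bar>\<theta>\<bar> * \<bar>x - y\<bar> \<le> 2 * \<bar>\<theta>\<bar> * c" by (intro mult_left_mono) auto
  then show ?thesis using small by (simp add: abs_mult)
qed

lemma k_bounds: "v \<in> {0..c} \<Longrightarrow> 1 / 2 \<le> k v y" "v \<in> {0..c} \<Longrightarrow> k v y \<le> 3 / 2"
  using field_le[of v "clamp y"] clamp_mem[of y] by (auto simp: k_def)

lemma k_diff: "\<bar>k v x - k v' y\<bar> \<le> 2 * \<bar>\<theta>\<bar> * (\<bar>v - v'\<bar> + \<bar>x - y\<bar>)"
proof -
  have "k v x - k v' y = 2 * \<theta> * ((v - v') - (clamp x - clamp y))" by (simp add: k_def algebra_simps)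
  then have "\<bar>k v x - k v' y\<bar> = 2 * \<bar>\<theta>\<bar> * \<bar>(v - v') - (clamp x - clamp y)\<bar>" by (simp add: abs_mult)
  also have "\<dots> \<le> 2 * \<bar>\<theta>\<bar> * (\<bar>v - v'\<bar> + \<bar>x - y\<bar>)"
    using clamp_lip[of x y] by (intro mult_left_mono) auto
  finally show ?thesis .
qed

lemma inverse_k_diff:
  assumes "v \<in> {0..c}" "v' \<in> {0..c}"
  shows "\<bar>1 / k v x - 1 / k v' y\<bar> \<le> 8 * \<bar>\<theta>\<bar> * (\<bar>v - v'\<bar> + \<bar>x - y\<bar>)"
proof -
  note b = k_bounds(1)[OF assms(1), of x] k_bounds(1)[OF assms(2), of y]
  have "1 / k v x - 1 / k v' y = (k v' y - k v x) / (k v x * k v' y)" using b by (simp add: field_simps)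
  then have "\<bar>1 / k v x - 1 / k v' y\<bar> = \<bar>k v x - k v' y\<bar> / (k v x * k v' y)"
    using b by (simp add: abs_mult abs_minus_commute)
  also have "\<dots> \<le> \<bar>k v x - k v' y\<bar> / (1 / 2 * (1 / 2))"
    using b by (intro divide_left_mono mult_mono) auto
  also have "\<dots> \<le> 8 * \<bar>\<theta>\<bar> * (\<bar>v - v'\<bar> + \<bar>x - y\<bar>)" using k_diff[of v x v' y] by simp
  finally show ?thesis .
qed

text \<open>Since \<open>k\<close> is at most 3/2, both roots are at least 1/2 and their sum is at
  least 1. So the difference of the roots does not exceed the difference of the squares.\<close>

lemma sqrt_inverse_k_diff:
  assumes "v \<in> {0..c}" "v' \<in> {0..c}"
  shows "\<bar>sqrt (1 / k v x) - sqrt (1 / k v' y)\<bar> \<le> 8 * \<bar>\<theta>\<bar> * (\<bar>v - v'\<bar> + \<bar>x - y\<bar>)"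
proof -
  have half: "1 / 2 \<le> sqrt (1 / k v x)" if "v \<in> {0..c}" for v x
    using k_bounds[OF that, of x] by (intro real_le_rsqrt) (auto simp: field_simps power2_eq_square)
  let ?p = "sqrt (1 / k v x)" and ?q = "sqrt (1 / k v' y)"
  have "1 \<le> ?p + ?q" using half[OF assms(1), of x] half[OF assms(2), of y] by linarith
  then have "\<bar>?p - ?q\<bar> \<le> \<bar>?p - ?q\<bar> * \<bar>?p + ?q\<bar>" by (simp add: mult_le_cancel_left1)
  also have "\<dots> = \<bar>?p\<^sup>2 - ?q\<^sup>2\<bar>" by (simp add: abs_mult[symmetric] power2_eq_square algebra_simps)
  also have "\<dots> = \<bar>1 / k v x - 1 / k v' y\<bar>"
    using k_bounds(1)[OF assms(1), of x] k_bounds(1)[OF assms(2), of y] by simp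
  finally show ?thesis using inverse_k_diff[OF assms, of x y] by linarith
qed

lemma measurable_k [measurable]: "k v \<in> borel_measurable borel"
  unfolding k_def by measurable

lemma integrable_inverse_k:
  assumes "prob_space \<mu>" "sets \<mu> = sets borel" "v \<in> {0..c}"
  shows "integrable \<mu> (\<lambda>y. 1 / k v y)"
proof (rule finite_measure.integrable_const_bound[OF prob_space.finite_measure[OF assms(1)]])
  show "AE y in \<mu>. norm (1 / k v y) \<le> 2"
  proof (rule AE_I2)
    fix y show "norm (1 / k v y) \<le> 2" using k_bounds(1)[OF assms(3), of y] by (simp add: field_simps)
  qed
  show "(\<lambda>y. 1 / k v y) \<in> borel_measurable \<mu>" by (simp add: measurable_cong_sets[OF assms(2) refl])
qed

text \<open>Intermediate value theorem. For \<open>v\<close> equal to 0 or \<open>c\<close> the sign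
  of \<open>v - clamp y\<close> does not depend on \<open>y\<close>, so the integrand lies on one
  side of 1 everywhere, and on opposite sides for the two end points; the sign of
  \<open>\<theta>\<close> decides which is which.\<close>

lemma exists_normalising:
  assumes "prob_space \<mu>" "sets \<mu> = sets borel"
  shows "\<exists>v\<in>{0..c}. (\<integral>y. 1 / k v y \<partial>\<mu>) = 1"
proof -
  interpret prob_space \<mu> by fact
  define \<Psi> where "\<Psi> v = (\<integral>y. 1 / k v y \<partial>\<mu>)" for v
  note int = integrable_inverse_k[OF assms]
  have "(8 * \<bar>\<theta>\<bar>)-lipschitz_on {0..c} \<Psi>"
  proof (rule lipschitz_onI)
    fix v v' assume v: "v \<in> {0..c}" "v' \<in> {0..c}"
    have "\<bar>\<Psi> v - \<Psi> v'\<bar> = \<bar>\<integral>y. 1 / k v y - 1 / k v' y \<partial>\<mu>\<bar>"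
      using int v by (simp add: \<Psi>_def)
    also have "\<dots> \<le> (\<integral>y. \<bar>1 / k v y - 1 / k v' y\<bar> \<partial>\<mu>)" by (rule integral_abs_bound)
    also have "\<dots> \<le> (\<integral>y. 8 * \<bar>\<theta>\<bar> * \<bar>v - v'\<bar> \<partial>\<mu>)"
    proof (rule integral_mono)
      fix y show "\<bar>1 / k v y - 1 / k v' y\<bar> \<le> 8 * \<bar>\<theta>\<bar> * \<bar>v - v'\<bar>"
        using inverse_k_diff[OF v, of y y] by simp
    qed (use int v in auto)
    finally show "dist (\<Psi> v) (\<Psi> v') \<le> 8 * \<bar>\<theta>\<bar> * dist v v'"
      by (simp add: dist_real_def prob_space)
  qed simp
  then have cont: "continuous_on {0..c} \<Psi>" by (rule lipschitz_on_continuous_on)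
  have ge: "\<Psi> v \<ge> 1" if "v \<in> {0..c}" "\<And>y. 2 * \<theta> * (v - clamp y) \<le> 0" for v
  proof -
    have "(\<integral>y. 1 \<partial>\<mu>) \<le> \<Psi> v" unfolding \<Psi>_def
    proof (rule integral_mono)
      fix y show "1 \<le> 1 / k v y"
        using k_bounds(1)[OF that(1), of y] that(2)[of y] by (simp add: k_def)
    qed (use int that in auto)
    then show ?thesis by (simp add: prob_space)
  qed
  have le: "\<Psi> v \<le> 1" if "v \<in> {0..c}" "\<And>y. 0 \<le> 2 * \<theta> * (v - clamp y)" for v
  proof -
    have "\<Psi> v \<le> (\<integral>y. 1 \<partial>\<mu>)" unfolding \<Psi>_def
    proof (rule integral_mono)
      fix y show "1 / k v y \<le> 1"
        using k_bounds(1)[OF that(1), of y] that(2)[of y] by (simp add: k_def)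
    qed (use int that in auto)
    then show ?thesis by (simp add: prob_space)
  qed
  have cl: "0 \<le> clamp y" "clamp y \<le> c" for y using clamp_mem[of y] by auto
  show ?thesis
  proof (cases "\<theta> > 0")
    case True
    have "1 \<le> \<Psi> 0" using c True cl by (intro ge) auto
    moreover have "\<Psi> c \<le> 1" using c True cl by (intro le) auto
    ultimately show ?thesis using IVT2'[of \<Psi> c 1 0] cont c unfolding \<Psi>_def by auto
  next
    case False
    then have "\<theta> < 0" using \<theta> by simp
    have neg: "2 * \<theta> * t \<le> 0" if "0 \<le> t" for t
      by (rule mult_nonpos_nonneg[OF _ that]) (use \<open>\<theta> < 0\<close> in simp)
    have "\<Psi> 0 \<le> 1"
    proof (rule le)
      fix y show "0 \<le> 2 * \<theta> * (0 - clamp y)" using neg[OF cl(1)[of y]] by simp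
    qed (use c in auto)
    moreover have "1 \<le> \<Psi> c"
    proof (rule ge)
      fix y show "2 * \<theta> * (c - clamp y) \<le> 0" using neg[of "c - clamp y"] cl(2)[of y] by simp
    qed (use c in auto)
    ultimately show ?thesis using IVT'[of \<Psi> 0 1 c] cont c unfolding \<Psi>_def by auto
  qed
qed

text \<open>With \<open>z = v + 1 / (2 * \<theta>)\<close> one has
  \<open>k v y = 2 * \<theta> * (z - y)\<close> on the support, so the normalising condition says
  that the Stieltjes transform at \<open>z\<close> is \<open>2 * \<theta>\<close>, and subtracting
  \<open>1 / (2 * \<theta>)\<close> from \<open>z\<close> gives the R-transform.\<close>

lemma v_fun_eqI:
  assumes "real_distribution \<rho>" and supp: "AE y in \<rho>. y \<in> {0..c}"
    and v: "v \<in> {0..c}" "(\<integral>y. 1 / k v y \<partial>\<rho>) = 1"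
  shows "v_fun c \<rho> \<theta> = v"
proof -
  interpret real_distribution \<rho> by fact
  define z where "z = v + 1 / (2 * \<theta>)"
  \<comment> \<open>The smallness of the field pushes \<open>z\<close> out of the interval, where
    the Stieltjes transform is inverted.\<close>
  have "2 * c \<le> \<bar>1 / (2 * \<theta>)\<bar>" using small \<theta> by (simp add: field_simps abs_mult)
  then have z: "z \<in> UNIV - {0..c}" using v c unfolding z_def by (auto simp: abs_if split: if_splits)
  have "stieltjes \<rho> z = (\<integral>y. 2 * \<theta> * (1 / k v y) \<partial>\<rho>)"
    unfolding stieltjes_def
  proof (rule integral_cong_AE)
    show "AE y in \<rho>. 1 / (z - y) = 2 * \<theta> * (1 / k v y)"
      using supp
    proof eventually_elim
      case (elim y)
      have "k v y = 2 * \<theta> * (z - y)" using \<theta> elim by (simp add: k_def z_def clamp_id algebra_simps)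
      then show ?case using \<theta> by simp
    qed
  qed auto
  also have "\<dots> = 2 * \<theta>"
    by (simp only: Bochner_Integration.integral_mult_right_zero v(2))
  finally have "stieltjes_inv c \<rho> (2 * \<theta>) = z"
    unfolding stieltjes_inv_def by (intro inv_into_f_eq stieltjes_inj[OF assms(1) supp c] z)
  then show ?thesis by (simp add: v_fun_def R_transform_def z_def)
qed

definition normal_mean where
  "normal_mean f v y = (\<integral>x. f (sqrt (1 / k v y) * x) \<partial>std_normal)"

text \<open>Both means are taken with the same standard normal variable \<open>t\<close>, so the
  arguments of \<open>f\<close> differ by the difference of the standard deviations times
  \<open>t\<close>.\<close>

lemma normal_mean_diff:
  assumes lip: "\<And>x y. \<bar>f x - f y\<bar> \<le> \<bar>x - y\<bar>" and f: "f \<in> borel_measurable borel"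
    and v: "v \<in> {0..c}" "v' \<in> {0..c}"
  shows "\<bar>normal_mean f v x - normal_mean f v' y\<bar>
    \<le> 8 * \<bar>\<theta>\<bar> * (\<integral>t. \<bar>t\<bar> \<partial>std_normal) * (\<bar>v - v'\<bar> + \<bar>x - y\<bar>)"
proof -
  let ?p = "sqrt (1 / k v x)" and ?q = "sqrt (1 / k v' y)"
  have int_abs: "integrable std_normal (\<lambda>t. \<bar>t\<bar>)" using std_normal_moments(1)[of 1] by auto
  note int = lipschitz_std_normal(1)[OF lip f]
  have "\<bar>normal_mean f v x - normal_mean f v' y\<bar> = \<bar>\<integral>t. f (?p * t) - f (?q * t) \<partial>std_normal\<bar>"
    unfolding normal_mean_def by (simp only: Bochner_Integration.integral_diff[OF int int])
  also have "\<dots> \<le> (\<integral>t. \<bar>f (?p * t) - f (?q * t)\<bar> \<partial>std_normal)" by (rule integral_abs_bound)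
  also have "\<dots> \<le> (\<integral>t. \<bar>?p - ?q\<bar> * \<bar>t\<bar> \<partial>std_normal)"
  proof (rule integral_mono)
    show "integrable std_normal (\<lambda>t. \<bar>f (?p * t) - f (?q * t)\<bar>)"
      by (intro integrable_abs Bochner_Integration.integrable_diff int)
    show "integrable std_normal (\<lambda>t. \<bar>?p - ?q\<bar> * \<bar>t\<bar>)"
      using int_abs by (rule integrable_mult_right)
    fix t show "\<bar>f (?p * t) - f (?q * t)\<bar> \<le> \<bar>?p - ?q\<bar> * \<bar>t\<bar>"
      using lip[of "?p * t" "?q * t"] by (simp only: abs_mult[symmetric] left_diff_distrib)
  qed
  also have "\<dots> = \<bar>?p - ?q\<bar> * (\<integral>t. \<bar>t\<bar> \<partial>std_normal)" by (rule Bochner_Integration.integral_mult_right_zero)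
  also have "\<dots> \<le> 8 * \<bar>\<theta>\<bar> * (\<bar>v - v'\<bar> + \<bar>x - y\<bar>) * (\<integral>t. \<bar>t\<bar> \<partial>std_normal)"
    by (intro mult_right_mono sqrt_inverse_k_diff v integral_nonneg) auto
  finally show ?thesis by (simp only: mult_ac)
qed

lemma normal_mean_clamp: "normal_mean f v (clamp y) = normal_mean f v y"
  using clamp_id[OF clamp_mem[of y]] by (simp add: normal_mean_def k_def)

lemma measurable_normal_mean:
  assumes "\<And>x y. \<bar>f x - f y\<bar> \<le> \<bar>x - y\<bar>" "f \<in> borel_measurable borel" "v \<in> {0..c}"
  shows "normal_mean f v \<in> borel_measurable borel"
proof -
  have "(8 * \<bar>\<theta>\<bar> * (\<integral>t. \<bar>t\<bar> \<partial>std_normal))-lipschitz_on UNIV (normal_mean f v)"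
  proof (rule lipschitz_onI)
    fix x y show "dist (normal_mean f v x) (normal_mean f v y) \<le> 8 * \<bar>\<theta>\<bar> * (\<integral>t. \<bar>t\<bar> \<partial>std_normal) * dist x y"
      using normal_mean_diff[OF assms(1,2,3,3), of x y] by (simp add: dist_real_def)
  qed (auto intro!: mult_nonneg_nonneg integral_nonneg)
  then show ?thesis
    by (intro borel_measurable_continuous_onI lipschitz_on_continuous_on)
qed

lemma integrable_normal_mean:
  assumes "prob_space \<mu>" "sets \<mu> = sets borel"
    and f: "\<And>x y. \<bar>f x - f y\<bar> \<le> \<bar>x - y\<bar>" "f \<in> borel_measurable borel" "v \<in> {0..c}"
  shows "integrable \<mu> (normal_mean f v)"
proof -
  interpret prob_space \<mu> by fact
  show ?thesis
  proof (rule integrable_const_bound, rule AE_I2)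
    fix y
    have "\<bar>normal_mean f v (clamp y) - normal_mean f v 0\<bar> \<le> 8 * \<bar>\<theta>\<bar> * (\<integral>t. \<bar>t\<bar> \<partial>std_normal) * (\<bar>v - v\<bar> + \<bar>clamp y - 0\<bar>)"
      by (rule normal_mean_diff[OF f(1,2,3,3)])
    also have "\<dots> \<le> 8 * \<bar>\<theta>\<bar> * (\<integral>t. \<bar>t\<bar> \<partial>std_normal) * c"
      using clamp_mem[of y] by (intro mult_left_mono mult_nonneg_nonneg integral_nonneg) auto
    finally show "norm (normal_mean f v y) \<le> \<bar>normal_mean f v 0\<bar> + 8 * \<bar>\<theta>\<bar> * (\<integral>t. \<bar>t\<bar> \<partial>std_normal) * c"
      unfolding normal_mean_clamp real_norm_def by linarith
    show "normal_mean f v \<in> borel_measurable \<mu>"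
      using measurable_normal_mean[OF f] by (simp add: measurable_cong_sets[OF assms(2) refl])
  qed
qed

text \<open>The integral of \<open>1 / k w y\<close> under \<open>\<rho>\<close> misses 1 by at most
  \<open>8 * \<bar>\<theta>\<bar> * \<delta>\<close>, because it equals 1 under
  \<open>\<mu>\<close>. It also misses 1 by at least
  \<open>2 * \<bar>\<theta>\<bar> * \<bar>w - v\<bar> * (4 / 9)\<close>, because its derivative in
  the shift is bounded away from 0. The quotient of the two constants is 9.\<close>

lemma normalising_stable:
  assumes \<mu>: "prob_space \<mu>" "sets \<mu> = sets borel" and \<rho>: "prob_space \<rho>" "sets \<rho> = sets borel"
    and w: "w \<in> {0..c}" "(\<integral>y. 1 / k w y \<partial>\<mu>) = 1"
    and v: "v \<in> {0..c}" "(\<integral>y. 1 / k v y \<partial>\<rho>) = 1"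
    and W: "wasserstein1 \<mu> \<rho> < ennreal \<delta>"
  shows "\<bar>w - v\<bar> \<le> 9 * \<delta>"
proof -
  interpret R: prob_space \<rho> by fact
  note int = integrable_inverse_k[OF \<rho>]
  have meas: "h \<in> borel_measurable borel \<Longrightarrow> h \<in> borel_measurable \<rho>" for h :: "real \<Rightarrow> real"
    by (simp add: measurable_cong_sets[OF \<rho>(2) refl])
  have "\<bar>(\<integral>y. 1 / k w y \<partial>\<mu>) - (\<integral>y. 1 / k w y \<partial>\<rho>)\<bar> \<le> 8 * \<bar>\<theta>\<bar> * \<delta>"
  proof (rule wasserstein1_lipschitz[OF W])
    fix x y show "\<bar>1 / k w x - 1 / k w y\<bar> \<le> 8 * \<bar>\<theta>\<bar> * \<bar>x - y\<bar>"
      using inverse_k_diff[OF w(1) w(1), of x y] by simp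
  qed (use integrable_inverse_k[OF \<mu> w(1)] int[OF w(1)] in auto)
  then have 1: "\<bar>(\<integral>y. 1 / k w y \<partial>\<rho>) - 1\<bar> \<le> 8 * \<bar>\<theta>\<bar> * \<delta>"
    using w(2) by linarith
  have prod_bounds: "4 / 9 \<le> 1 / (k w y * k v y)" "1 / (k w y * k v y) \<le> 4" for y
  proof -
    note b = k_bounds[OF w(1), of y] k_bounds[OF v(1), of y]
    have "k w y * k v y \<le> 3 / 2 * (3 / 2)" "1 / 2 * (1 / 2) \<le> k w y * k v y"
      using b by (intro mult_mono; simp)+
    then show "4 / 9 \<le> 1 / (k w y * k v y)" "1 / (k w y * k v y) \<le> 4"
      using b by (simp_all add: field_simps)
  qed
  have int_prod: "integrable \<rho> (\<lambda>y. 1 / (k w y * k v y))"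
  proof (rule R.integrable_const_bound, rule AE_I2)
    show "norm (1 / (k w y * k v y)) \<le> 4" for y using prod_bounds[of y] by simp
    show "(\<lambda>y. 1 / (k w y * k v y)) \<in> borel_measurable \<rho>" by (rule meas) measurable
  qed
  have "(\<integral>y. 1 / k w y \<partial>\<rho>) - 1 = (\<integral>y. 1 / k w y - 1 / k v y \<partial>\<rho>)"
    using int[OF w(1)] int[OF v(1)] v(2) by simp
  also have "\<dots> = (\<integral>y. 2 * \<theta> * (v - w) * (1 / (k w y * k v y)) \<partial>\<rho>)"
  proof (rule Bochner_Integration.integral_cong[OF refl])
    fix y
    have "k w y > 0" "k v y > 0" using k_bounds[OF w(1), of y] k_bounds[OF v(1), of y] by linarith+
    then have "1 / k w y - 1 / k v y = (k v y - k w y) * (1 / (k w y * k v y))" by (simp add: field_simps)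
    also have "k v y - k w y = 2 * \<theta> * (v - w)" by (simp add: k_def algebra_simps)
    finally show "1 / k w y - 1 / k v y = 2 * \<theta> * (v - w) * (1 / (k w y * k v y))" .
  qed
  also have "\<dots> = 2 * \<theta> * (v - w) * (\<integral>y. 1 / (k w y * k v y) \<partial>\<rho>)"
    by (rule Bochner_Integration.integral_mult_right_zero)
  finally have 2: "\<bar>(\<integral>y. 1 / k w y \<partial>\<rho>) - 1\<bar> = 2 * \<bar>\<theta>\<bar> * \<bar>w - v\<bar> * \<bar>\<integral>y. 1 / (k w y * k v y) \<partial>\<rho>\<bar>"
    by (simp only: abs_mult abs_minus_commute)
  have "(\<integral>y. 4 / 9 \<partial>\<rho>) \<le> (\<integral>y. 1 / (k w y * k v y) \<partial>\<rho>)"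
    using int_prod prod_bounds by (intro integral_mono) auto
  then have "4 / 9 \<le> \<bar>\<integral>y. 1 / (k w y * k v y) \<partial>\<rho>\<bar>" by (simp add: R.prob_space)
  then have "2 * \<bar>\<theta>\<bar> * \<bar>w - v\<bar> * (4 / 9) \<le> 8 * \<bar>\<theta>\<bar> * \<delta>"
    using mult_left_mono[of "4 / 9" _ "2 * \<bar>\<theta>\<bar> * \<bar>w - v\<bar>"] 1 2 by fastforce
  then have "\<bar>\<theta>\<bar> * \<bar>w - v\<bar> \<le> \<bar>\<theta>\<bar> * (9 * \<delta>)" by (simp add: mult_ac)
  then show ?thesis using \<theta> by simp
qed

text \<open>Change the measure at fixed shift, then the shift at fixed measure. The second error is
  9 times the first by \<open>normalising_stable\<close>, whence 80 as ten times the Lipschitz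
  factor 8.\<close>

lemma normal_mean_stable:
  assumes \<mu>: "prob_space \<mu>" "sets \<mu> = sets borel" and \<rho>: "prob_space \<rho>" "sets \<rho> = sets borel"
    and w: "w \<in> {0..c}" "(\<integral>y. 1 / k w y \<partial>\<mu>) = 1"
    and v: "v \<in> {0..c}" "(\<integral>y. 1 / k v y \<partial>\<rho>) = 1"
    and W: "wasserstein1 \<mu> \<rho> < ennreal \<delta>"
    and f: "\<And>x y. \<bar>f x - f y\<bar> \<le> \<bar>x - y\<bar>" "f \<in> borel_measurable borel"
  shows "\<bar>(\<integral>y. normal_mean f w y \<partial>\<mu>) - (\<integral>y. normal_mean f v y \<partial>\<rho>)\<bar>
    \<le> 80 * \<bar>\<theta>\<bar> * (\<integral>t. \<bar>t\<bar> \<partial>std_normal) * \<delta>"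
proof -
  interpret R: prob_space \<rho> by fact
  define L where "L = 8 * \<bar>\<theta>\<bar> * (\<integral>t. \<bar>t\<bar> \<partial>std_normal)"
  have L: "L \<ge> 0" unfolding L_def by (intro mult_nonneg_nonneg integral_nonneg) auto
  note int = integrable_normal_mean[OF \<rho> f]
  have 1: "\<bar>(\<integral>y. normal_mean f w y \<partial>\<mu>) - (\<integral>y. normal_mean f w y \<partial>\<rho>)\<bar> \<le> L * \<delta>"
  proof (rule wasserstein1_lipschitz[OF W _ L])
    fix x y show "\<bar>normal_mean f w x - normal_mean f w y\<bar> \<le> L * \<bar>x - y\<bar>"
      using normal_mean_diff[OF f w(1) w(1), of x y] by (simp add: L_def)
  qed (use measurable_normal_mean[OF f w(1)] integrable_normal_mean[OF \<mu> f w(1)] int[OF w(1)] in auto)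
  have "\<bar>(\<integral>y. normal_mean f w y \<partial>\<rho>) - (\<integral>y. normal_mean f v y \<partial>\<rho>)\<bar>
    = \<bar>\<integral>y. normal_mean f w y - normal_mean f v y \<partial>\<rho>\<bar>"
    using int[OF w(1)] int[OF v(1)] by simp
  also have "\<dots> \<le> (\<integral>y. \<bar>normal_mean f w y - normal_mean f v y\<bar> \<partial>\<rho>)" by (rule integral_abs_bound)
  also have "\<dots> \<le> (\<integral>y. L * \<bar>w - v\<bar> \<partial>\<rho>)"
  proof (rule integral_mono)
    fix y show "\<bar>normal_mean f w y - normal_mean f v y\<bar> \<le> L * \<bar>w - v\<bar>"
      using normal_mean_diff[OF f w(1) v(1), of y y] by (simp add: L_def)
  qed (use int[OF w(1)] int[OF v(1)] in auto)
  also have "\<dots> = L * \<bar>w - v\<bar>" by (simp add: R.prob_space)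
  also have "\<dots> \<le> L * (9 * \<delta>)"
    by (intro mult_left_mono L normalising_stable[OF \<mu> \<rho> w v W])
  finally have "\<bar>(\<integral>y. normal_mean f w y \<partial>\<mu>) - (\<integral>y. normal_mean f v y \<partial>\<rho>)\<bar> \<le> L * \<delta> + L * (9 * \<delta>)"
    using 1 by linarith
  also have "\<dots> = 80 * \<bar>\<theta>\<bar> * (\<integral>t. \<bar>t\<bar> \<partial>std_normal) * \<delta>" by (simp add: L_def)
  finally show ?thesis .
qed

text \<open>On the interval clamping has no effect and \<open>v_fun\<close> equals \<open>v\<close>;
  outside it the indicator removes the marginals, and \<open>\<rho>\<close> has no mass
  there.\<close>

lemma limit_mean_eq:
  assumes \<rho>: "real_distribution \<rho>" and supp: "AE y in \<rho>. y \<in> {0..c}"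
    and v: "v \<in> {0..c}" "(\<integral>y. 1 / k v y \<partial>\<rho>) = 1"
    and f: "\<And>x y. \<bar>f x - f y\<bar> \<le> \<bar>x - y\<bar>" "f \<in> borel_measurable borel"
  shows "(LINT y:{0..c}|\<rho>. (\<integral>x. f x \<partial>limit_marginal c \<rho> \<theta> y)) = (\<integral>y. normal_mean f v y \<partial>\<rho>)"
proof -
  interpret real_distribution \<rho> by fact
  have [measurable]: "normal_mean f v \<in> borel_measurable borel" by (rule measurable_normal_mean[OF f v(1)])
  have eq: "(\<integral>x. f x \<partial>limit_marginal c \<rho> \<theta> y) = normal_mean f v y" if "y \<in> {0..c}" for y
  proof -
    have var: "limit_variance c \<rho> \<theta> y = 1 / k v y"
      using that by (simp add: limit_variance_def v_fun_eqI[OF \<rho> supp v] k_def clamp_id)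
    have "limit_variance c \<rho> \<theta> y > 0"
      unfolding var using k_bounds(1)[OF v(1), of y] by simp
    from integral_limit_marginal[OF this f(2)] show ?thesis by (simp only: var normal_mean_def)
  qed
  have "(LINT y:{0..c}|\<rho>. (\<integral>x. f x \<partial>limit_marginal c \<rho> \<theta> y)) = (LINT y:{0..c}|\<rho>. normal_mean f v y)"
    unfolding set_lebesgue_integral_def
    by (rule Bochner_Integration.integral_cong[OF refl]) (use eq in \<open>auto simp: indicator_def\<close>)
  also have "\<dots> = (\<integral>y. normal_mean f v y \<partial>\<rho>)"
    unfolding set_lebesgue_integral_def
  proof (rule integral_cong_AE)
    show "AE y in \<rho>. indicator {0..c} y *\<^sub>R normal_mean f v y = normal_mean f v y"
      using supp by eventually_elim auto
  qed auto
  finally show ?thesis .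
qed

end

section \<open>Application to the empirical measures\<close>

lemma empirical_measure_prob:
  assumes "N \<ge> 1"
  shows "prob_space (empirical_measure N a)" "sets (empirical_measure N a) = sets borel"
proof -
  have "prob_space (uniform_count_measure {1..N})"
    using assms by (intro prob_space_uniform_count_measure) auto
  then show "prob_space (empirical_measure N a)"
    unfolding empirical_measure_def by (rule prob_space.prob_space_distr) simp
  show "sets (empirical_measure N a) = sets borel" by (simp add: empirical_measure_def)
qed

lemma C1_deriv_bound_lipschitz:
  fixes f :: "real \<Rightarrow> real"
  assumes "f C1_differentiable_on UNIV" and "\<And>x. \<bar>deriv f x\<bar> \<le> 1"
  shows "\<bar>f x - f y\<bar> \<le> \<bar>x - y\<bar>"
proof -
  have D: "(f has_field_derivative deriv f x) (at x)" for x
  proof -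
    have "f differentiable at x"
      using assms(1) by (auto simp: C1_differentiable_on_eq)
    then show ?thesis by (simp add: DERIV_deriv_iff_real_differentiable)
  qed
  have "norm (f x - f y) \<le> 1 * norm (x - y)"
    by (rule field_differentiable_bound[of UNIV]) (use D assms(2) in auto)
  then show ?thesis by simp
qed

theorem mainTheorem4:
  fixes \<gamma>max :: real and \<gamma> :: "nat \<Rightarrow> nat \<Rightarrow> real" and \<rho> :: "real measure"
    and \<theta> :: real and f :: "real \<Rightarrow> real"
  assumes "\<gamma>max > 0"
    and "\<And>N i. N \<ge> 1 \<Longrightarrow> i \<in> {1..N} \<Longrightarrow> \<gamma> N i \<in> {0..\<gamma>max}"
    and "real_distribution \<rho>" and "measure \<rho> {0..\<gamma>max} = 1"
    and "(\<lambda>N. wasserstein1 (empirical_measure N (\<gamma> N)) \<rho>) \<longlonglongrightarrow> 0"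
    and "\<theta> \<noteq> 0" and "2 * (9 + sqrt 17) * \<gamma>max * \<bar>\<theta>\<bar> < 1"
    and "f C1_differentiable_on UNIV" and "\<And>x. \<bar>deriv f x\<bar> \<le> 1"
  shows "(\<lambda>N. gibbs_mean N (\<gamma> N) \<theta>
            (\<lambda>g. ((\<Sum>i\<in>{1..N}. f (g i)) / real N
                  - (LINT y:{0..\<gamma>max}|\<rho>. (\<integral>x. f x \<partial>limit_marginal \<gamma>max \<rho> \<theta> y)))\<^sup>2))
         \<longlonglongrightarrow> 0"
proof -
  interpret R: real_distribution \<rho> by fact
  interpret small_field \<theta> \<gamma>max
  proof
    \<comment> \<open>Dropping the root term leaves
      \<open>18 * \<gamma>max * \<bar>\<theta>\<bar> < 1\<close>, from which the bound 1/2
      follows.\<close>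
    have "0 \<le> sqrt 17 * (\<gamma>max * \<bar>\<theta>\<bar>)" using assms(1) by simp
    then show "2 * \<bar>\<theta>\<bar> * \<gamma>max \<le> 1 / 2" using assms(7) by (simp add: algebra_simps)
  qed fact+
  have lip: "\<bar>f x - f y\<bar> \<le> \<bar>x - y\<bar>" for x y
    by (rule C1_deriv_bound_lipschitz[OF assms(8,9)])
  have "1-lipschitz_on UNIV f" by (rule lipschitz_onI) (use lip in \<open>auto simp: dist_real_def\<close>)
  then have f[measurable]: "f \<in> borel_measurable borel"
    by (intro borel_measurable_continuous_onI lipschitz_on_continuous_on)
  have supp: "AE y in \<rho>. y \<in> {0..\<gamma>max}"
    using assms(4) by (intro R.AE_prob_1) auto
  have \<rho>: "prob_space \<rho>" "sets \<rho> = sets borel" by (simp_all add: R.prob_space_axioms)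
  obtain v where v: "v \<in> {0..\<gamma>max}" "(\<integral>y. 1 / k v y \<partial>\<rho>) = 1"
    using exists_normalising[OF \<rho>] by blast
  define m where "m = (\<integral>y. normal_mean f v y \<partial>\<rho>)"
  note m = limit_mean_eq[OF assms(3) supp v lip f, folded m_def]
  obtain w where w: "\<And>N. N \<ge> 1 \<Longrightarrow> w N \<in> {0..\<gamma>max} \<and> (\<integral>y. 1 / k (w N) y \<partial>empirical_measure N (\<gamma> N)) = 1"
  proof -
    \<comment> \<open>The implication covers \<open>N = 0\<close>, where the empirical measure is
      not a probability measure and the value of \<open>w\<close> is arbitrary.\<close>
    have "\<forall>N. \<exists>u. N \<ge> 1 \<longrightarrow> u \<in> {0..\<gamma>max} \<and> (\<integral>y. 1 / k u y \<partial>empirical_measure N (\<gamma> N)) = 1"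
    proof
      fix N
      show "\<exists>u. N \<ge> 1 \<longrightarrow> u \<in> {0..\<gamma>max} \<and> (\<integral>y. 1 / k u y \<partial>empirical_measure N (\<gamma> N)) = 1"
      proof (cases "N \<ge> 1")
        case True
        from exists_normalising[OF empirical_measure_prob[OF True]] show ?thesis by (auto simp only: Bex_def)
      qed simp
    qed
    from choice[OF this] show ?thesis using that by blast
  qed
  define \<beta> where "\<beta> N = (\<integral>y. normal_mean f (w N) y \<partial>empirical_measure N (\<gamma> N)) - m" for N
  have bound: "0 \<le> gibbs_mean N (\<gamma> N) \<theta> (\<lambda>g. ((\<Sum>i\<in>{1..N}. f (g i)) / N - m)\<^sup>2) \<and>
      gibbs_mean N (\<gamma> N) \<theta> (\<lambda>g. ((\<Sum>i\<in>{1..N}. f (g i)) / N - m)\<^sup>2) \<le> exp 40 * (66 / N + 3 * (\<beta> N)\<^sup>2)"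
    if N: "N \<ge> 1" for N
  proof -
    have wN: "w N \<in> {0..\<gamma>max}" "(\<integral>y. 1 / k (w N) y \<partial>empirical_measure N (\<gamma> N)) = 1" using w[OF N] by auto
    have kN: "k (w N) (\<gamma> N i) = 1 + 2 * \<theta> * (w N - \<gamma> N i)" if "i \<in> {1..N}" for i
      using assms(2)[OF N that] by (simp add: k_def clamp_id)
    interpret T: tilted_gaussian N "\<gamma> N" \<theta> "w N"
    proof
      show "\<bar>2 * \<theta> * (w N - \<gamma> N i)\<bar> \<le> 1 / 2" if "i \<in> {1..N}" for i
        by (rule field_le[OF wN(1) assms(2)[OF N that]])
      have "(\<Sum>i\<in>{1..N}. 1 / k (w N) (\<gamma> N i)) / N = 1"
        using wN(2) by (subst (asm) integral_empirical_measure[OF N]) auto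
      then have "(\<Sum>i\<in>{1..N}. 1 / k (w N) (\<gamma> N i)) = N" using N by (simp add: field_simps)
      then show "(\<Sum>i\<in>{1..N}. 1 / (1 + 2 * \<theta> * (w N - \<gamma> N i))) = N"
        by (simp only: kN cong: sum.cong)
    qed fact
    \<comment> \<open>Writes the mean under the product measure as an integral against the empirical
      measure; the Wasserstein estimates can then be applied to the bias
      \<open>\<beta> N\<close>.\<close>
    have "(\<Sum>i\<in>{1..N}. \<integral>x. f (sqrt (T.s i) * x) \<partial>std_normal) / N = (\<integral>y. normal_mean f (w N) y \<partial>empirical_measure N (\<gamma> N))"
      unfolding integral_empirical_measure[OF N measurable_normal_mean[OF lip f wN(1)]]
      by (simp only: normal_mean_def T.s_def kN cong: sum.cong)
    then have "(\<Sum>i\<in>{1..N}. \<integral>x. f (sqrt (T.s i) * x) \<partial>std_normal) / N - m = \<beta> N" by (simp only: \<beta>_def)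
    then show ?thesis using T.gibbs_lipschitz_bound[OF lip f, of m] by simp
  qed
  have \<beta>_lim: "\<beta> \<longlonglongrightarrow> 0"
  proof (rule LIMSEQ_I)
    fix e :: real assume e: "e > 0"
    define A where "A = 80 * \<bar>\<theta>\<bar> * (\<integral>t. \<bar>t\<bar> \<partial>std_normal)"
    have A: "A \<ge> 0" unfolding A_def by (intro mult_nonneg_nonneg integral_nonneg) auto
    \<comment> \<open>Adding 1 makes the denominator positive and gives the strict inequality
      \<open>A * \<delta> < e\<close>.\<close>
    define \<delta> where "\<delta> = e / (A + 1)"
    have \<delta>: "\<delta> > 0" "A * \<delta> < e" using A e by (auto simp: \<delta>_def field_simps)
    have "eventually (\<lambda>N. wasserstein1 (empirical_measure N (\<gamma> N)) \<rho> < ennreal \<delta>) sequentially"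
      using assms(5) by (rule order_tendstoD) (use \<delta> in simp)
    then obtain N0 where N0: "\<And>N. N \<ge> N0 \<Longrightarrow> wasserstein1 (empirical_measure N (\<gamma> N)) \<rho> < ennreal \<delta>"
      by (auto simp: eventually_sequentially)
    have "norm (\<beta> N - 0) < e" if "N \<ge> max 1 N0" for N
    proof -
      have N: "N \<ge> 1" "N \<ge> N0" using that by auto
      have "\<bar>\<beta> N\<bar> \<le> A * \<delta>"
        unfolding \<beta>_def m_def A_def
        using w[OF N(1)] by (intro normal_mean_stable[OF empirical_measure_prob[OF N(1)] \<rho> _ _ v N0[OF N(2)] lip f]) auto
      then show ?thesis using \<delta> by simp
    qed
    then show "\<exists>no. \<forall>N\<ge>no. norm (\<beta> N - 0) < e" by blast
  qed
  have "(\<lambda>N. exp 40 * (66 / real N + 3 * (\<beta> N)\<^sup>2)) \<longlonglongrightarrow> exp 40 * (0 + 3 * 0\<^sup>2)"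
    by (intro tendsto_intros \<beta>_lim lim_const_over_n)
  then have upper: "(\<lambda>N. exp 40 * (66 / real N + 3 * (\<beta> N)\<^sup>2)) \<longlonglongrightarrow> 0" by simp
  show ?thesis
    unfolding m
  proof (rule tendsto_sandwich[OF _ _ tendsto_const upper])
    show "\<forall>\<^sub>F N in sequentially. 0 \<le> gibbs_mean N (\<gamma> N) \<theta> (\<lambda>g. ((\<Sum>i\<in>{1..N}. f (g i)) / real N - m)\<^sup>2)"
      using bound by (intro eventually_sequentiallyI[of 1]) blast
    show "\<forall>\<^sub>F N in sequentially. gibbs_mean N (\<gamma> N) \<theta> (\<lambda>g. ((\<Sum>i\<in>{1..N}. f (g i)) / real N - m)\<^sup>2)
        \<le> exp 40 * (66 / real N + 3 * (\<beta> N)\<^sup>2)"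
      using bound by (intro eventually_sequentiallyI[of 1]) blast
  qed
qed

end
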